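(* Let $\mathcal{B}\subset\mathcal{B}(G)$ be a von Neumann algebra, $\vartheta$ a normal unital $*$-endomorphism of $\mathcal{B}$ and $\vartheta'$ a normal unital $*$-endomorphism of $\mathcal{B}'$, generating discrete $E_0$-semigroups $(\vartheta^n)_{n\in\mathbb{N}_0}$ and $(\vartheta'^n)_{n\in\mathbb{N}_0}$. Then these discrete $E_0$-semigroups can be paired if and only if there is an isomorphism of product systems from $(E_n)_{n\in\mathbb{N}_0}$ onto $(F_n)_{n\in\mathbb{N}_0}$ (their product systems are commutants of each other).
   Context: A pairing of the discrete semigroups is a group $(\alpha_n)_{n\in\mathbb{Z}}$ of $*$-automorphisms of $\mathcal{B}(G)$ with $\alpha_{-n}(b)=\vartheta^n(b)$ and $\alpha_n(b')=\vartheta'^n(b')$ for all $n\in\mathbb{N}_0$, $b\in\mathcal{B}$, $b'\in\mathcal{B}'$. Product system of $(\vartheta^n)$: $E_n:=\mathcal{B}$ with right action by operator multiplication, inner product $x^*y$, left action $b.x=\vartheta^n(b)x$, product $(x_k,y_n)\mapsto\vartheta^n(x_k)y_n\in E_{k+n}$. $F_n:=\{y\in\mathcal{B}(G):\vartheta'^n(b')y=yb'\ \forall b'\in\mathcal{B}'\}$ with left and right $\mathcal{B}$-actions by operator multiplication, inner product $y^*z$, product $(y_k,z_n)\mapsto y_kz_n$. An isomorphism is a family of surjective inner-product-preserving $\mathcal{B}$-bilinear maps $u_n:E_n\to F_n$, $u_0=\mathrm{id}_{\mathcal{B}}$, with $u_{k+n}(\vartheta^n(x_k)y_n)=u_k(x_k)u_n(y_n)$.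 *)

theory Defs
  imports "HOL-Analysis.Analysis"
begin

text \<open>HOL-Analysis only provides real inner product spaces. A complex Hilbert space
is a real Hilbert space (real inner product = real part of the complex one) together
with an orthogonal complex structure cJ (multiplication by the imaginary unit).\<close>

class complex_hilbert = real_inner + complete_space +
  fixes cJ :: "'a \<Rightarrow> 'a"
  assumes cJ_add: "cJ (x + y) = cJ x + cJ y"
    and cJ_scaleR: "cJ (scaleR r x) = scaleR r (cJ x)"
    and cJ_cJ: "cJ (cJ x) = - x"
    and inner_cJ: "inner (cJ x) (cJ y) = inner x y"

definition scaleC :: "complex \<Rightarrow> 'a::complex_hilbert \<Rightarrow> 'a" where
  "scaleC c x = Re c *\<^sub>R x + Im c *\<^sub>R cJ x"

type_synonym 'a op = "'a \<Rightarrow> 'a"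

definition BG :: "('a::complex_hilbert) op set" where
  "BG = {T. bounded_linear T \<and> (\<forall>c x. T (scaleC c x) = scaleC c (T x))}"

text \<open>Hilbert space adjoint (for complex-linear bounded operators the adjoint w.r.t.
the real part of the inner product is the complex adjoint)\<close>
definition adj :: "('a::complex_hilbert) op \<Rightarrow> 'a op" where
  "adj T = (SOME S. S \<in> BG \<and> (\<forall>x y. inner (T x) y = inner x (S y)))"

definition opadd :: "('a::complex_hilbert) op \<Rightarrow> 'a op \<Rightarrow> 'a op" where
  "opadd S T = (\<lambda>x. S x + T x)"

definition opscale :: "complex \<Rightarrow> ('a::complex_hilbert) op \<Rightarrow> 'a op" where
  "opscale c T = (\<lambda>x. scaleC c (T x))"

definition commutant :: "('a::complex_hilbert) op set \<Rightarrow> 'a op set" where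
  "commutant S = {T \<in> BG. \<forall>s\<in>S. T \<circ> s = s \<circ> T}"

definition von_neumann_algebra :: "('a::complex_hilbert) op set \<Rightarrow> bool" where
  "von_neumann_algebra B \<longleftrightarrow> B \<subseteq> BG \<and> id \<in> B
     \<and> (\<forall>x\<in>B. \<forall>y\<in>B. opadd x y \<in> B \<and> x \<circ> y \<in> B)
     \<and> (\<forall>c. \<forall>x\<in>B. opscale c x \<in> B)
     \<and> (\<forall>x\<in>B. adj x \<in> B)
     \<and> commutant (commutant B) = B"

definition op_le :: "('a::complex_hilbert) op \<Rightarrow> 'a op \<Rightarrow> bool" where
  "op_le S T \<longleftrightarrow> (\<forall>x. inner x (S x) \<le> inner x (T x))"

definition self_adjoint :: "('a::complex_hilbert) op \<Rightarrow> bool" where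
  "self_adjoint T \<longleftrightarrow> T \<in> BG \<and> adj T = T"

definition is_sa_lub :: "('a::complex_hilbert) op set \<Rightarrow> 'a op \<Rightarrow> bool" where
  "is_sa_lub D s \<longleftrightarrow> self_adjoint s \<and> (\<forall>d\<in>D. op_le d s)
     \<and> (\<forall>t. self_adjoint t \<and> (\<forall>d\<in>D. op_le d t) \<longrightarrow> op_le s t)"

definition normal_map :: "('a::complex_hilbert) op set \<Rightarrow> ('a op \<Rightarrow> 'a op) \<Rightarrow> bool" where
  "normal_map B \<theta> \<longleftrightarrow> (\<forall>D s. D \<subseteq> B \<and> D \<noteq> {} \<and> (\<forall>d\<in>D. self_adjoint d)
       \<and> (\<forall>a\<in>D. \<forall>b\<in>D. \<exists>c\<in>D. op_le a c \<and> op_le b c)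
       \<and> is_sa_lub D s \<longrightarrow> is_sa_lub (\<theta> ` D) (\<theta> s))"

definition star_hom :: "('a::complex_hilbert) op set \<Rightarrow> 'a op set \<Rightarrow> ('a op \<Rightarrow> 'a op) \<Rightarrow> bool" where
  "star_hom A C \<theta> \<longleftrightarrow> (\<forall>x\<in>A. \<theta> x \<in> C)
     \<and> (\<forall>x\<in>A. \<forall>y\<in>A. \<theta> (opadd x y) = opadd (\<theta> x) (\<theta> y) \<and> \<theta> (x \<circ> y) = \<theta> x \<circ> \<theta> y)
     \<and> (\<forall>c. \<forall>x\<in>A. \<theta> (opscale c x) = opscale c (\<theta> x))
     \<and> (\<forall>x\<in>A. \<theta> (adj x) = adj (\<theta> x))
     \<and> \<theta> id = id"

definition normal_unital_star_endo :: "('a::complex_hilbert) op set \<Rightarrow> ('a op \<Rightarrow> 'a op) \<Rightarrow> bool" where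
  "normal_unital_star_endo B \<theta> \<longleftrightarrow> star_hom B B \<theta> \<and> normal_map B \<theta>"

definition star_automorphism_BG :: "(('a::complex_hilbert) op \<Rightarrow> 'a op) \<Rightarrow> bool" where
  "star_automorphism_BG \<alpha> \<longleftrightarrow> star_hom BG BG \<alpha> \<and> bij_betw \<alpha> BG BG"

definition pairing :: "('a::complex_hilbert) op set \<Rightarrow> ('a op \<Rightarrow> 'a op) \<Rightarrow> ('a op \<Rightarrow> 'a op)
     \<Rightarrow> (int \<Rightarrow> 'a op \<Rightarrow> 'a op) \<Rightarrow> bool" where
  "pairing B \<theta> \<theta>' \<alpha> \<longleftrightarrow>
     (\<forall>n. star_automorphism_BG (\<alpha> n))
     \<and> (\<forall>x\<in>BG. \<alpha> 0 x = x)
     \<and> (\<forall>m n. \<forall>x\<in>BG. \<alpha> (m + n) x = \<alpha> m (\<alpha> n x))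
     \<and> (\<forall>n::nat. \<forall>b\<in>B. \<alpha> (- int n) b = (\<theta> ^^ n) b)
     \<and> (\<forall>n::nat. \<forall>b'\<in>commutant B. \<alpha> (int n) b' = (\<theta>' ^^ n) b')"

definition can_be_paired :: "('a::complex_hilbert) op set \<Rightarrow> ('a op \<Rightarrow> 'a op) \<Rightarrow> ('a op \<Rightarrow> 'a op) \<Rightarrow> bool" where
  "can_be_paired B \<theta> \<theta>' \<longleftrightarrow> (\<exists>\<alpha>. pairing B \<theta> \<theta>' \<alpha>)"

text \<open>E_n = B with right action by multiplication, inner product x^* y, left action
b.x = theta^n(b) x, product (x_k, y_n) maps to theta^n(x_k) y_n.\<close>

definition F_space :: "('a::complex_hilbert) op set \<Rightarrow> ('a op \<Rightarrow> 'a op) \<Rightarrow> nat \<Rightarrow> 'a op set" where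
  "F_space B \<theta>' n = {y \<in> BG. \<forall>b'\<in>commutant B. (\<theta>' ^^ n) b' \<circ> y = y \<circ> b'}"

definition product_system_iso :: "('a::complex_hilbert) op set \<Rightarrow> ('a op \<Rightarrow> 'a op) \<Rightarrow> ('a op \<Rightarrow> 'a op)
     \<Rightarrow> (nat \<Rightarrow> 'a op \<Rightarrow> 'a op) \<Rightarrow> bool" where
  "product_system_iso B \<theta> \<theta>' u \<longleftrightarrow>
     (\<forall>n. u n ` B = F_space B \<theta>' n)
     \<and> (\<forall>n. \<forall>x\<in>B. \<forall>y\<in>B. adj (u n x) \<circ> u n y = adj x \<circ> y)
     \<and> (\<forall>n. \<forall>x\<in>B. \<forall>y\<in>B. u n (opadd x y) = opadd (u n x) (u n y))
     \<and> (\<forall>n c. \<forall>x\<in>B. u n (opscale c x) = opscale c (u n x))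
     \<and> (\<forall>n. \<forall>b\<in>B. \<forall>x\<in>B. u n ((\<theta> ^^ n) b \<circ> x) = b \<circ> u n x)
     \<and> (\<forall>n. \<forall>b\<in>B. \<forall>x\<in>B. u n (x \<circ> b) = u n x \<circ> b)
     \<and> (\<forall>x\<in>B. u 0 x = x)
     \<and> (\<forall>k n. \<forall>x\<in>B. \<forall>y\<in>B. u (k + n) ((\<theta> ^^ n) x \<circ> y) = u k x \<circ> u n y)"

end

theory Submission
  imports Defs
begin

text \<open>Both conditions are equivalent to the existence of a unitary \<open>w\<close> with \<open>\<theta> b = w\<^sup>* b w\<close> on \<open>B\<close> and
  \<open>\<theta>' b' = w b' w\<^sup>*\<close> on the commutant \<open>B'\<close>. Given \<open>w\<close>, put \<open>\<alpha>\<^sub>n = Ad w\<^sup>n\<close> and \<open>u\<^sub>n x = w\<^sup>n x\<close>.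
  A pairing yields \<open>w\<close> because the automorphism \<open>\<alpha>\<^sub>1\<close> is inner: \<open>w v = \<alpha>\<^sub>1 (|v\<rangle>\<langle>e|) f\<close> for unit vectors
  \<open>e\<close> and \<open>f\<close> with \<open>\<alpha>\<^sub>1 (|e\<rangle>\<langle>e|) f = f\<close>. An isomorphism \<open>u\<close> yields the isometry \<open>w = u\<^sub>1 1\<close> with \<open>F\<^sub>1 = w B\<close>.
  It is surjective because the ranges of the intertwiners in \<open>F\<^sub>1\<close> span a dense subspace. This is where normality of
  \<open>\<theta>'\<close> enters: if all intertwiners from the identity representation to a normal representation
  \<open>\<pi>\<close> of \<open>M = B'\<close> have range orthogonal to \<open>\<xi>\<close>, then for each \<open>\<eta>\<close> there are self-adjoint \<open>x \<in> M\<close> with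
  \<open>x \<eta> \<approx> \<eta>\<close> and \<open>\<pi> x \<xi> \<approx> 0\<close>; monotone limits of resolvents of sums of their squares give \<open>c \<in> M\<close> with
  \<open>\<pi> c \<xi> = 0\<close> and \<open>c \<eta> \<noteq> 0\<close>. Hence the left ideal annihilating \<open>\<xi>\<close> has an approximate unit
  increasing to \<open>id\<close>, and normality forces \<open>\<xi> = 0\<close>.\<close>

subsection \<open>Orthogonal projections\<close>

text \<open>A sequence in \<open>K\<close> minimising the distance to \<open>x\<close> is Cauchy by
  the parallelogram law. Its limit \<open>p\<close> attains the distance, and a nonzero
  \<open>inner (x - p) k\<close> would allow a shorter one.\<close>

lemma projection_exists:
  fixes K :: "'b::{real_inner,complete_space} set"
  assumes "subspace K" "closed K"
  shows "\<exists>p\<in>K. \<forall>k\<in>K. inner (x - p) k = 0"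
proof -
  define d where "d = Inf ((\<lambda>k. norm (x - k)) ` K)"
  have K0: "0 \<in> K" using assms(1) subspace_0 by blast
  have bdd: "bdd_below ((\<lambda>k. norm (x - k)) ` K)" by (rule bdd_belowI[of _ 0]) auto
  have d_le: "d \<le> norm (x - k)" if "k \<in> K" for k
    unfolding d_def using bdd that by (auto intro: cInf_lower)
  have d0: "d \<ge> 0" unfolding d_def using K0 by (intro cInf_greatest) auto
  have "\<exists>k\<in>K. norm (x - k) < d + 1 / Suc n" for n
    using cInf_lessD[of "(\<lambda>k. norm (x - k)) ` K" "d + 1 / Suc n"] K0 unfolding d_def by auto
  then obtain f where fK: "\<And>n. f n \<in> K" and fd: "\<And>n. norm (x - f n) < d + 1 / Suc n"
    by metis
  have lim: "(\<lambda>n. norm (x - f n)) \<longlonglongrightarrow> d"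
  proof (rule tendsto_sandwich)
    show "\<forall>\<^sub>F n in sequentially. d \<le> norm (x - f n)" using d_le fK by simp
    show "\<forall>\<^sub>F n in sequentially. norm (x - f n) \<le> d + 1 / Suc n"
      using fd by (simp add: less_imp_le)
    have "(\<lambda>n. d + 1 / real (Suc n)) \<longlonglongrightarrow> d + 0"
      using LIMSEQ_inverse_real_of_nat by (intro tendsto_intros) (simp add: inverse_eq_divide)
    then show "(\<lambda>n. d + 1 / real (Suc n)) \<longlonglongrightarrow> d" by simp
  qed auto
  \<comment> \<open>The midpoint of \<open>f m\<close> and \<open>f n\<close> lies in
    \<open>K\<close>, hence at distance at least \<open>d\<close> from \<open>x\<close>; the
    parallelogram law converts this into a bound on the gap.\<close>
  have par: "(norm (f m - f n))\<^sup>2 \<le> 2 * ((norm (x - f m))\<^sup>2 - d\<^sup>2) + 2 * ((norm (x - f n))\<^sup>2 - d\<^sup>2)"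
    for m n
  proof -
    have mid: "(1/2) *\<^sub>R (f m + f n) \<in> K"
      using assms(1) fK by (intro subspace_scale subspace_add)
    have "d\<^sup>2 \<le> (norm (x - (1/2) *\<^sub>R (f m + f n)))\<^sup>2"
      using d_le[OF mid] d0 by (simp add: power_mono)
    moreover have "(norm (f m - f n))\<^sup>2 + 4 * (norm (x - (1/2) *\<^sub>R (f m + f n)))\<^sup>2
        = 2 * (norm (x - f m))\<^sup>2 + 2 * (norm (x - f n))\<^sup>2"
      unfolding power2_norm_eq_inner
      by (simp add: inner_diff_left inner_diff_right inner_add_left inner_add_right
          inner_commute algebra_simps)
    ultimately show ?thesis by argo
  qed
  have "Cauchy f"
  proof (rule metric_CauchyI)
    fix e :: real assume "e > 0"
    have "(\<lambda>n. (norm (x - f n))\<^sup>2 - d\<^sup>2) \<longlonglongrightarrow> d\<^sup>2 - d\<^sup>2" by (intro tendsto_intros lim)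
    then have "\<forall>\<^sub>F n in sequentially. (norm (x - f n))\<^sup>2 - d\<^sup>2 < e\<^sup>2 / 4"
      using \<open>e > 0\<close> by (intro order_tendstoD(2)) auto
    then obtain M where M: "\<And>n. n \<ge> M \<Longrightarrow> (norm (x - f n))\<^sup>2 - d\<^sup>2 < e\<^sup>2 / 4"
      by (auto simp: eventually_sequentially)
    have "dist (f m) (f n) < e" if "m \<ge> M" "n \<ge> M" for m n
    proof -
      have "(norm (f m - f n))\<^sup>2 < e\<^sup>2" using par[of m n] M[OF that(1)] M[OF that(2)] by argo
      then show ?thesis using \<open>e > 0\<close> by (simp add: dist_norm power2_less_imp_less)
    qed
    then show "\<exists>M. \<forall>m\<ge>M. \<forall>n\<ge>M. dist (f m) (f n) < e" by blast
  qed
  then obtain p where p: "f \<longlonglongrightarrow> p" using Cauchy_convergent convergent_def by blast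
  have pK: "p \<in> K" using assms(2) fK p closed_sequentially by blast
  have pd: "norm (x - p) = d"
  proof (rule LIMSEQ_unique[OF _ lim])
    show "(\<lambda>n. norm (x - f n)) \<longlonglongrightarrow> norm (x - p)" by (intro tendsto_intros p)
  qed
  have "inner (x - p) k = 0" if "k \<in> K" for k
  proof (rule ccontr)
    assume neq: "inner (x - p) k \<noteq> 0"
    then have k: "inner k k > 0" by auto
    \<comment> \<open>This \<open>t\<close> minimises the quadratic polynomial obtained by moving
      \<open>p\<close> along \<open>k\<close>.\<close>
    define t where "t = inner (x - p) k / inner k k"
    have "p + t *\<^sub>R k \<in> K" using assms(1) pK that by (intro subspace_scale subspace_add)
    then have "d\<^sup>2 \<le> (norm (x - (p + t *\<^sub>R k)))\<^sup>2" using d_le d0 by (simp add: power_mono)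
    also have "\<dots> = d\<^sup>2 - 2 * t * inner (x - p) k + t * t * inner k k"
      unfolding pd[symmetric] power2_norm_eq_inner
      by (simp add: inner_diff_left inner_diff_right inner_add_left inner_add_right
          inner_commute algebra_simps)
    also have "\<dots> = d\<^sup>2 - (inner (x - p) k)\<^sup>2 / inner k k"
      using k by (simp add: t_def field_simps power2_eq_square)
    also have "\<dots> < d\<^sup>2" using neq k by simp
    finally show False by simp
  qed
  then show ?thesis using pK by blast
qed

definition orth_proj :: "'b::{real_inner,complete_space} set \<Rightarrow> 'b \<Rightarrow> 'b" where
  "orth_proj K x = (SOME p. p \<in> K \<and> (\<forall>k\<in>K. inner (x - p) k = 0))"

context
  fixes K :: "'b::{real_inner,complete_space} set"
  assumes K: "subspace K" "closed K"
begin

lemma orth_proj_in: "orth_proj K x \<in> K"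
  and orth_proj_inner: "k \<in> K \<Longrightarrow> inner (x - orth_proj K x) k = 0"
proof -
  have "\<exists>p. p \<in> K \<and> (\<forall>k\<in>K. inner (x - p) k = 0)" using projection_exists[OF K] by blast
  from someI_ex[OF this] show "orth_proj K x \<in> K" "k \<in> K \<Longrightarrow> inner (x - orth_proj K x) k = 0"
    unfolding orth_proj_def by blast+
qed

lemma orth_proj_unique:
  assumes "p \<in> K" "\<And>k. k \<in> K \<Longrightarrow> inner (x - p) k = 0"
  shows "orth_proj K x = p"
proof -
  let ?r = "orth_proj K x - p"
  have r: "?r \<in> K" using orth_proj_in assms(1) K(1) subspace_diff by blast
  have "inner ?r ?r = inner (x - p) ?r - inner (x - orth_proj K x) ?r"
    by (simp add: inner_diff_left)
  also have "\<dots> = 0" using assms(2)[OF r] orth_proj_inner[OF r] by simp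
  finally show ?thesis by simp
qed

lemma orth_proj_fixed: "k \<in> K \<Longrightarrow> orth_proj K k = k"
  by (rule orth_proj_unique) auto

lemma bounded_linear_orth_proj: "bounded_linear (orth_proj K)"
proof (rule bounded_linear_intro[of _ 1])
  fix x y r
  show "orth_proj K (x + y) = orth_proj K x + orth_proj K y"
  proof (rule orth_proj_unique)
    show "orth_proj K x + orth_proj K y \<in> K" using orth_proj_in K(1) subspace_add by blast
    fix k assume "k \<in> K"
    from orth_proj_inner[OF this, of x] orth_proj_inner[OF this, of y]
    show "inner (x + y - (orth_proj K x + orth_proj K y)) k = 0"
      by (simp add: inner_diff_left inner_add_left)
  qed
  show "orth_proj K (r *\<^sub>R x) = r *\<^sub>R orth_proj K x"
  proof (rule orth_proj_unique)
    show "r *\<^sub>R orth_proj K x \<in> K" using orth_proj_in K(1) subspace_scale by blast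
    fix k assume "k \<in> K"
    from orth_proj_inner[OF this, of x]
    show "inner (r *\<^sub>R x - r *\<^sub>R orth_proj K x) k = 0"
      by (simp add: inner_diff_left)
  qed
  have "inner (x - orth_proj K x) (orth_proj K x) = 0" by (rule orth_proj_inner[OF orth_proj_in])
  then have "(norm (orth_proj K x))\<^sup>2 = inner x (orth_proj K x)"
    by (simp add: power2_norm_eq_inner inner_diff_left)
  also have "\<dots> \<le> norm x * norm (orth_proj K x)" by (rule norm_cauchy_schwarz)
  finally show "norm (orth_proj K x) \<le> norm x * 1"
    by (cases "orth_proj K x = 0") (auto simp: power2_eq_square)
qed

lemma inner_orth_proj: "inner (orth_proj K x) y = inner x (orth_proj K y)"
proof -
  have "inner (x - orth_proj K x) (orth_proj K y) = 0" "inner (y - orth_proj K y) (orth_proj K x) = 0"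
    using orth_proj_inner orth_proj_in by blast+
  then show ?thesis by (simp add: inner_diff_left) (metis inner_commute)
qed

text \<open>Invariance under \<open>T\<close> keeps the image of the projected part in
  \<open>K\<close>; invariance under the adjoint \<open>T'\<close> keeps the image of the remainder
  orthogonal to \<open>K\<close>.\<close>

lemma orth_proj_commute:
  assumes lin: "linear T" and inv: "\<And>k. k \<in> K \<Longrightarrow> T k \<in> K" "\<And>k. k \<in> K \<Longrightarrow> T' k \<in> K"
    and adj: "\<And>x y. inner (T x) y = inner x (T' y)"
  shows "orth_proj K (T x) = T (orth_proj K x)"
proof (rule orth_proj_unique)
  show "T (orth_proj K x) \<in> K" using orth_proj_in inv by blast
  fix k assume "k \<in> K"
  have "inner (T x - T (orth_proj K x)) k = inner (x - orth_proj K x) (T' k)"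
    using lin adj by (simp add: linear_diff[symmetric])
  then show "inner (T x - T (orth_proj K x)) k = 0" using orth_proj_inner inv \<open>k \<in> K\<close> by simp
qed

lemma subspace_eq_UNIV:
  assumes "\<And>x. (\<And>k. k \<in> K \<Longrightarrow> inner x k = 0) \<Longrightarrow> x = 0"
  shows "K = UNIV"
proof -
  have "x \<in> K" for x
  proof -
    have "x - orth_proj K x = 0" using assms orth_proj_inner by blast
    then show ?thesis using orth_proj_in[of x] by simp
  qed
  then show ?thesis by blast
qed

end

text \<open>Let \<open>z\<close> be the component orthogonal to the kernel of some vector outside
  the kernel. Every \<open>x\<close> differs from a multiple of \<open>z\<close> by a kernel
  element, so \<open>inner x z\<close> determines \<open>f x\<close>.\<close>

lemma riesz_representation:
  fixes f :: "'b::{real_inner,complete_space} \<Rightarrow> real"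
  assumes f: "bounded_linear f"
  shows "\<exists>z. \<forall>x. f x = inner x z"
proof (cases "\<forall>x. f x = 0")
  case True then show ?thesis by (intro exI[of _ 0]) auto
next
  case False
  then obtain a where a: "f a \<noteq> 0" by blast
  interpret f: bounded_linear f by (rule f)
  define K where "K = {x. f x = 0}"
  have K: "subspace K" unfolding K_def by (auto simp: subspace_def f.add f.scaleR f.zero)
  have Kc: "closed K" unfolding K_def
    by (intro closed_Collect_eq continuous_intros f.continuous_on)
  define z where "z = a - orth_proj K a"
  have fz: "f z = f a" using orth_proj_in[OF K Kc, of a] by (simp add: z_def f.diff K_def)
  have z: "inner z z \<noteq> 0" using fz a f.zero by auto
  have "f x = inner x ((f z / inner z z) *\<^sub>R z)" for x
  proof -
    have "x - (f x / f z) *\<^sub>R z \<in> K" using fz a by (simp add: K_def f.diff f.scaleR)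
    then have "inner z (x - (f x / f z) *\<^sub>R z) = 0" unfolding z_def by (rule orth_proj_inner[OF K Kc])
    then show ?thesis using fz a z by (simp add: inner_diff_right inner_commute field_simps)
  qed
  then show ?thesis by blast
qed

subsection \<open>Operators and adjoints\<close>

text \<open>\<open>scaleC c\<close> is a real combination of the identity and \<open>cJ\<close>, so
  for a real-linear map commuting with \<open>cJ\<close> amounts to complex linearity.\<close>

lemma BG_iff: "T \<in> BG \<longleftrightarrow> bounded_linear T \<and> (\<forall>x. T (cJ x) = cJ (T x))"
proof
  assume T: "T \<in> BG"
  have "T (scaleC \<i> x) = scaleC \<i> (T x)" for x using T by (auto simp: BG_def)
  then show "bounded_linear T \<and> (\<forall>x. T (cJ x) = cJ (T x))"
    using T by (auto simp: BG_def scaleC_def)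
next
  assume T: "bounded_linear T \<and> (\<forall>x. T (cJ x) = cJ (T x))"
  then interpret T: bounded_linear T by blast
  show "T \<in> BG" using T by (auto simp: BG_def scaleC_def T.add T.scaleR)
qed

lemma BG_bounded_linear: "T \<in> BG \<Longrightarrow> bounded_linear T" and BG_cJ: "T \<in> BG \<Longrightarrow> T (cJ x) = cJ (T x)"
  and BG_linear: "T \<in> BG \<Longrightarrow> linear T"
  by (auto simp: BG_iff bounded_linear.linear)

lemma BG_scaleC: "T \<in> BG \<Longrightarrow> T (scaleC c x) = scaleC c (T x)" by (simp add: BG_def)

lemma BG_add: "T \<in> BG \<Longrightarrow> T (x + y) = T x + T y"
  and BG_diff: "T \<in> BG \<Longrightarrow> T (x - y) = T x - T y"
  and BG_scaleR: "T \<in> BG \<Longrightarrow> T (r *\<^sub>R x) = r *\<^sub>R T x"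
  and BG_zero: "T \<in> BG \<Longrightarrow> T 0 = 0"
  using BG_linear[of T] by (auto simp: linear_add linear_diff linear_scale linear_0)

lemma cJ_zero: "cJ (0::'a::complex_hilbert) = 0" using cJ_scaleR[of 0 "0::'a"] by simp
lemma cJ_minus: "cJ (- x) = - cJ (x::'a::complex_hilbert)" using cJ_scaleR[of "-1" x] by simp
lemma cJ_diff: "cJ (x - y) = cJ x - cJ (y::'a::complex_hilbert)"
  using cJ_add[of x "-y"] by (simp add: cJ_minus)

lemma norm_cJ: "norm (cJ x) = norm (x::'a::complex_hilbert)" by (simp add: norm_eq inner_cJ)

lemma inner_cJ_left: "inner (cJ x) y = - inner x (cJ (y::'a::complex_hilbert))"
  using inner_cJ[of x "cJ y"] by (simp add: cJ_cJ)

lemma inner_cJ_self: "inner x (cJ (x::'a::complex_hilbert)) = 0"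
  using inner_cJ_left[of x x] by (simp add: inner_commute)

lemma bounded_linear_cJ: "bounded_linear (cJ :: 'a::complex_hilbert \<Rightarrow> 'a)"
  by (rule bounded_linear_intro[of _ 1]) (auto simp: cJ_add cJ_scaleR norm_cJ)

lemma id_BG: "id \<in> BG" by (simp add: BG_iff id_def bounded_linear_ident)

lemma comp_BG: "S \<in> BG \<Longrightarrow> T \<in> BG \<Longrightarrow> S \<circ> T \<in> BG"
  unfolding BG_iff comp_def by (auto intro: bounded_linear_compose)

lemma opadd_BG: "S \<in> BG \<Longrightarrow> T \<in> BG \<Longrightarrow> opadd S T \<in> BG"
  unfolding BG_iff opadd_def by (auto intro: bounded_linear_add simp: cJ_add)

lemma bounded_linear_scaleC: "bounded_linear (scaleC c :: 'a::complex_hilbert \<Rightarrow> 'a)"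
  unfolding scaleC_def
  by (intro bounded_linear_add bounded_linear_const_scaleR bounded_linear_compose[OF bounded_linear_scaleR_right]
      bounded_linear_ident bounded_linear_cJ)

lemma opscale_BG: "T \<in> BG \<Longrightarrow> opscale c T \<in> BG"
  unfolding BG_iff opscale_def
  by (auto intro: bounded_linear_compose[OF bounded_linear_scaleC])
    (simp add: scaleC_def cJ_add cJ_scaleR)

text \<open>Riesz representation for each fixed \<open>y\<close> gives \<open>S y\<close>. The map
  \<open>S\<close> commutes with \<open>cJ\<close> because \<open>T\<close> does and
  \<open>cJ\<close> is skew for the real inner product.\<close>

lemma adj_exists:
  assumes T: "T \<in> BG"
  shows "\<exists>S. S \<in> BG \<and> (\<forall>x y. inner (T x) y = inner x (S y))"
proof -
  have "\<exists>z. \<forall>x. inner (T x) y = inner x z" for y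
    by (rule riesz_representation, rule bounded_linear_compose[OF bounded_linear_inner_left BG_bounded_linear[OF T]])
  then obtain S where S: "\<And>x y. inner (T x) y = inner x (S y)" by metis
  obtain C where C: "\<And>x. norm (T x) \<le> norm x * C" "C \<ge> 0"
    using BG_bounded_linear[OF T] bounded_linear.nonneg_bounded by blast
  have eq: "a = b" if "\<And>x. inner x a = inner x b" for a b :: 'a
    using that[of "a - b"] by (metis inner_diff_right inner_eq_zero_iff right_minus_eq)
  have "bounded_linear S"
  proof (rule bounded_linear_intro[of _ C])
    show "S (x + y) = S x + S y" for x y by (rule eq) (simp add: S[symmetric] inner_add_right)
    show "S (r *\<^sub>R x) = r *\<^sub>R S x" for r x by (rule eq) (simp add: S[symmetric])
    fix y
    have "(norm (S y))\<^sup>2 = inner (T (S y)) y" by (simp add: S power2_norm_eq_inner)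
    also have "\<dots> \<le> norm (T (S y)) * norm y" by (rule norm_cauchy_schwarz)
    also have "\<dots> \<le> norm (S y) * C * norm y" by (intro mult_right_mono C) auto
    finally show "norm (S y) \<le> norm y * C"
      by (cases "S y = 0") (auto simp: power2_eq_square C mult_ac)
  qed
  moreover have "S (cJ y) = cJ (S y)" for y
  proof (rule eq)
    fix x
    have "inner x (S (cJ y)) = - inner (cJ (T x)) y" by (simp add: S[symmetric] inner_cJ_left)
    also have "\<dots> = inner x (cJ (S y))" by (simp add: BG_cJ[OF T, symmetric] S inner_cJ_left)
    finally show "inner x (S (cJ y)) = inner x (cJ (S y))" .
  qed
  ultimately show ?thesis using S by (auto simp: BG_iff)
qed

lemma adj_BG: "T \<in> BG \<Longrightarrow> adj T \<in> BG"
  and inner_adj: "T \<in> BG \<Longrightarrow> inner (T x) y = inner x (adj T y)"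
  using someI_ex[OF adj_exists[of T]] unfolding adj_def by blast+

lemma inner_adj': "T \<in> BG \<Longrightarrow> inner (adj T x) y = inner x (T y)"
  by (metis inner_adj inner_commute)

lemma adj_unique:
  assumes "T \<in> BG" "\<And>x y. inner (T x) y = inner x (S y)"
  shows "adj T = S"
proof
  fix y
  have "inner (adj T y - S y) (adj T y - S y) = 0"
    using assms inner_adj[OF assms(1), of "adj T y - S y" y] by (simp add: inner_diff_right)
  then show "adj T y = S y" by simp
qed

lemma adj_adj: "T \<in> BG \<Longrightarrow> adj (adj T) = T"
  by (rule adj_unique) (auto simp: adj_BG inner_adj')

lemma adj_comp: "S \<in> BG \<Longrightarrow> T \<in> BG \<Longrightarrow> adj (S \<circ> T) = adj T \<circ> adj S"
  by (rule adj_unique) (auto simp: comp_BG inner_adj)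

lemma adj_id: "adj id = id"
  by (rule adj_unique) (auto simp: id_BG)

lemma self_adjoint_iff: "self_adjoint T \<longleftrightarrow> T \<in> BG \<and> (\<forall>x y. inner (T x) y = inner x (T y))"
  unfolding self_adjoint_def using adj_unique[of T T] inner_adj[of T] by metis

lemma self_adjoint_BG: "self_adjoint T \<Longrightarrow> T \<in> BG"
  and self_adjoint_inner: "self_adjoint T \<Longrightarrow> inner (T x) y = inner x (T y)"
  by (auto simp: self_adjoint_iff)

lemma self_adjoint_id: "self_adjoint id" by (simp add: self_adjoint_iff id_BG)

lemma scaleC_minus_one: "scaleC (-1) x = - x" by (simp add: scaleC_def)

lemma scaleC_zero: "scaleC 0 x = 0" by (simp add: scaleC_def)

lemma opadd_apply: "opadd S T v = S v + T v" by (simp add: opadd_def)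

lemma opscale_zero_apply: "opscale 0 T v = 0" by (simp add: opscale_def scaleC_zero)


text \<open>Built from \<open>opadd\<close> and \<open>opscale\<close>, so that the closure
  properties of a von Neumann algebra apply directly.\<close>

definition op_compl :: "('a::complex_hilbert) op \<Rightarrow> 'a op" where
  "op_compl T = opadd id (opscale (-1) T)"

lemma op_compl_apply: "op_compl T v = v - T v"
  by (simp add: op_compl_def opadd_def opscale_def scaleC_minus_one)

lemma op_compl_sa: "self_adjoint T \<Longrightarrow> self_adjoint (op_compl T)"
  by (auto simp: self_adjoint_iff op_compl_apply inner_diff_left inner_diff_right)
    (simp add: op_compl_def opadd_BG opscale_BG id_BG)

subsection \<open>Resolvents of sums of squares\<close>

text \<open>Lists make sums of squares easy to dominate: concatenation adds the quadratic forms. The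
  empty sum is zero written as a multiple of \<open>id\<close>, which keeps it in the
  algebra.\<close>

primrec gram :: "('a::complex_hilbert) op list \<Rightarrow> 'a op" where
  "gram [] = opscale 0 id"
| "gram (x # xs) = opadd (adj x \<circ> x) (gram xs)"

text \<open>The defect \<open>id - resolvent\<close> of a positive \<open>S\<close> is \<open>S / (1 + S)\<close>, which replaces the
  spectral projections of \<open>S\<close>.\<close>

definition resolvent :: "('a::complex_hilbert) op \<Rightarrow> 'a op" where
  "resolvent S = inv (opadd id S)"

definition defect :: "('a::complex_hilbert) op \<Rightarrow> 'a op" where
  "defect S = op_compl (resolvent S)"

lemma defect_apply: "defect S v = v - resolvent S v"
  by (simp add: defect_def op_compl_apply)

locale positive_op =
  fixes S :: "('a::complex_hilbert) op"
  assumes sa: "self_adjoint S" and pos: "0 \<le> inner v (S v)"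
begin

lemma BG: "S \<in> BG" using sa by (rule self_adjoint_BG)

text \<open>Cauchy-Schwarz on \<open>inner v (v + S v)\<close> bounds \<open>1 + S\<close> from
  below. This yields injectivity, closed range and contractivity of the resolvent.\<close>

lemma norm_le: "norm v \<le> norm (v + S v)"
proof -
  have "(norm v)\<^sup>2 \<le> inner v (v + S v)" using pos by (simp add: inner_add_right power2_norm_eq_inner)
  also have "\<dots> \<le> norm v * norm (v + S v)" by (rule norm_cauchy_schwarz)
  finally show ?thesis by (cases "v = 0") (auto simp: power2_eq_square)
qed

text \<open>The lower bound gives injectivity and closed range. The range is dense since
  \<open>x\<close> orthogonal to it satisfies \<open>inner x x + inner x (S x) = 0\<close>.\<close>

lemma bij: "bij (opadd id S)"
proof -
  have lin: "linear (opadd id S)" using BG_linear[OF opadd_BG[OF id_BG BG]] .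
  have "inj (opadd id S)"
  proof (subst linear_injective_0[OF lin], intro allI impI)
    fix v assume "opadd id S v = 0"
    then show "v = 0" using norm_le[of v] by (simp add: opadd_def)
  qed
  moreover have "range (opadd id S) = UNIV"
  proof (rule subspace_eq_UNIV)
    show "subspace (range (opadd id S))" using lin by (simp add: linear_subspace_image)
    show "closed (range (opadd id S))"
    proof (rule complete_imp_closed, rule completeI)
      fix f assume f: "\<forall>n. f n \<in> range (opadd id S)" "Cauchy f"
      then have "\<forall>n. \<exists>g. f n = g + S g" by (auto simp: opadd_def image_iff)
      then obtain g where g: "\<And>n. f n = g n + S (g n)" by metis
      have "Cauchy g"
      proof (rule metric_CauchyI)
        fix e :: real assume "e > 0"
        then obtain M where M: "\<And>m n. m \<ge> M \<Longrightarrow> n \<ge> M \<Longrightarrow> dist (f m) (f n) < e"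
          using f(2) metric_CauchyD by blast
        have "dist (g m) (g n) \<le> dist (f m) (f n)" for m n
          using norm_le[of "g m - g n"] by (simp add: dist_norm g BG_diff[OF BG] add_diff_add)
        then show "\<exists>M. \<forall>m\<ge>M. \<forall>n\<ge>M. dist (g m) (g n) < e" using M le_less_trans by blast
      qed
      then obtain l where l: "g \<longlonglongrightarrow> l" using Cauchy_convergent convergent_def by blast
      have "f \<longlonglongrightarrow> opadd id S l" unfolding g opadd_def id_def
        by (intro tendsto_add l bounded_linear.tendsto[OF BG_bounded_linear[OF BG] l])
      then show "\<exists>l\<in>range (opadd id S). f \<longlonglongrightarrow> l" by blast
    qed
    fix x assume "\<And>k. k \<in> range (opadd id S) \<Longrightarrow> inner x k = 0"
    then have "inner x (opadd id S x) = 0" by blast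
    then have "inner x x + inner x (S x) = 0" by (simp add: opadd_def inner_add_right)
    then have "inner x x = 0" using pos[of x] inner_ge_zero[of x] by linarith
    then show "x = 0" by simp
  qed
  ultimately show ?thesis by (simp add: bij_def)
qed

lemma resolvent_right: "resolvent S v + S (resolvent S v) = v"
  using surj_f_inv_f[OF bij_is_surj[OF bij], of v] by (simp add: resolvent_def opadd_def)

lemma resolvent_eqI: "u + S u = v \<Longrightarrow> resolvent S v = u"
  using inv_f_f[OF bij_is_inj[OF bij], of u] by (auto simp: resolvent_def opadd_def)

lemma resolvent_BG: "resolvent S \<in> BG"
  unfolding BG_iff
proof (intro conjI allI bounded_linear_intro[of _ 1])
  show "resolvent S (x + y) = resolvent S x + resolvent S y" for x y
    using resolvent_right[of x] resolvent_right[of y]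
    by (intro resolvent_eqI) (metis BG_add[OF BG] add.assoc add.left_commute)
  show "resolvent S (r *\<^sub>R x) = r *\<^sub>R resolvent S x" for r x
    by (intro resolvent_eqI) (simp add: BG_scaleR[OF BG] scaleR_add_right[symmetric] resolvent_right)
  show "resolvent S (cJ x) = cJ (resolvent S x)" for x
    by (intro resolvent_eqI) (simp add: BG_cJ[OF BG] cJ_add[symmetric] resolvent_right)
  show "norm (resolvent S x) \<le> norm x * 1" for x
    using norm_le[of "resolvent S x"] by (simp add: resolvent_right)
qed

lemma resolvent_sa: "self_adjoint (resolvent S)"
proof -
  have "inner (resolvent S x) y = inner x (resolvent S y)" for x y
  proof -
    let ?a = "resolvent S x" and ?b = "resolvent S y"
    have "inner ?a (?b + S ?b) = inner (?a + S ?a) ?b"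
      using self_adjoint_inner[OF sa, of ?a ?b] by (simp add: inner_add_left inner_add_right)
    then show ?thesis by (simp add: resolvent_right)
  qed
  then show ?thesis by (simp add: self_adjoint_iff resolvent_BG)
qed

lemma resolvent_inner: "inner v (resolvent S v)
    = inner (resolvent S v) (resolvent S v) + inner (resolvent S v) (S (resolvent S v))"
  using resolvent_right[of v] by (metis inner_add_left inner_commute)

lemma resolvent_ge: "0 \<le> inner v (resolvent S v)"
  using pos by (simp add: resolvent_inner)

lemma resolvent_le: "inner v (resolvent S v) \<le> inner v v"
proof -
  have "inner v (resolvent S v) \<le> norm v * norm (resolvent S v)" by (rule norm_cauchy_schwarz)
  also have "\<dots> \<le> norm v * norm v"
    using norm_le[of "resolvent S v"] by (intro mult_left_mono) (simp_all add: resolvent_right)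
  finally show ?thesis by (simp add: power2_norm_eq_inner[symmetric] power2_eq_square)
qed

lemma defect_sa: "self_adjoint (defect S)"
  unfolding defect_def by (rule op_compl_sa[OF resolvent_sa])

lemma defect_ge: "0 \<le> inner v (defect S v)" and defect_le_id: "inner v (defect S v) \<le> inner v v"
  using resolvent_ge[of v] resolvent_le[of v] by (simp_all add: defect_apply inner_diff_right)

text \<open>With \<open>v = u + S u\<close> the two forms differ by
  \<open>inner (S u) (S u) + inner (S u) (S (S u))\<close>, a nonnegative number.\<close>

lemma defect_le: "inner v (defect S v) \<le> inner v (S v)"
proof -
  define u where "u = resolvent S v"
  have v: "v = u + S u" by (simp add: u_def resolvent_right)
  have "inner v (defect S v) = inner u (S u) + inner (S u) (S u)"
    by (metis add_diff_cancel_left' defect_apply inner_add_left u_def v)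
  also have "\<dots> \<le> inner u (S u) + 2 * inner (S u) (S u) + inner (S u) (S (S u))"
    using pos[of "S u"] by simp
  also have "\<dots> = inner v (S v)"
    using self_adjoint_inner[OF sa, of u "S u"] by (simp add: v BG_add[OF BG] inner_add_left inner_add_right)
  finally show ?thesis .
qed

text \<open>This places resolvents of positive elements of a von Neumann algebra in its
  bicommutant.\<close>

lemma resolvent_commute:
  assumes T: "T \<in> BG" and "T \<circ> S = S \<circ> T"
  shows "T \<circ> resolvent S = resolvent S \<circ> T"
proof
  fix v
  have "T (resolvent S v) + S (T (resolvent S v)) = T v"
    using assms(2) by (metis BG_add[OF T] comp_apply resolvent_right)
  then show "(T \<circ> resolvent S) v = (resolvent S \<circ> T) v"
    unfolding comp_apply by (rule resolvent_eqI[symmetric])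
qed

end

text \<open>With \<open>a\<close> and \<open>b\<close> the two resolvent vectors, expand positivity
  of \<open>1 + S\<close> at \<open>b - a\<close> and enlarge \<open>inner b (S b)\<close> to
  \<open>inner b (T b)\<close>. What remains is
  \<open>0 \<le> inner a v - inner b v\<close>.\<close>

lemma resolvent_antimono:
  assumes "positive_op S" "positive_op T" "\<And>v. inner v (S v) \<le> inner v (T v)"
  shows "inner v (resolvent T v) \<le> inner v (resolvent S v)"
proof -
  interpret S: positive_op S by fact
  interpret T: positive_op T by fact
  define a b where "a = resolvent S v" and "b = resolvent T v"
  have a: "a + S a = v" and b: "b + T b = v" by (simp_all add: a_def b_def S.resolvent_right T.resolvent_right)
  have "0 \<le> inner (b - a) (b - a) + inner (b - a) (S (b - a))"
    using S.pos by (simp add: add_nonneg_nonneg)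
  also have "\<dots> = inner b b + inner b (S b) - 2 * inner b (a + S a) + inner a (a + S a)"
    using self_adjoint_inner[OF S.sa, of a b]
    by (simp add: BG_diff[OF S.BG] inner_diff_left inner_diff_right inner_add_right inner_commute)
  also have "\<dots> \<le> inner b (b + T b) - 2 * inner b v + inner a v"
    using assms(3)[of b] by (simp add: a inner_add_right)
  finally show ?thesis by (simp add: a b inner_commute flip: a_def b_def)
qed

lemma inner_gram_Cons:
  "x \<in> BG \<Longrightarrow> inner v (gram (x # xs) v) = inner (x v) (x v) + inner v (gram xs v)"
  by (simp add: opadd_def inner_add_right inner_adj)

lemma inner_gram_Nil: "inner v (gram [] v) = 0"
  by (simp add: opscale_def scaleC_zero)

lemma gram_positive: "set xs \<subseteq> BG \<Longrightarrow> positive_op (gram xs)"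
proof (induction xs)
  case Nil
  have "self_adjoint (gram [] :: 'a op)"
    by (auto simp: self_adjoint_iff opscale_BG id_BG) (simp add: opscale_def scaleC_zero)
  then show ?case by (auto intro!: positive_op.intro simp: inner_gram_Nil simp del: gram.simps)
next
  case (Cons x xs)
  then interpret positive_op "gram xs" by simp
  have x: "x \<in> BG" using Cons by simp
  have "gram (x # xs) \<in> BG" by (simp add: opadd_BG comp_BG adj_BG x BG)
  then have "self_adjoint (gram (x # xs))"
    using self_adjoint_inner[OF sa]
    by (auto simp: self_adjoint_iff opadd_def inner_add_left inner_add_right inner_adj[OF x, symmetric]
        inner_adj'[OF x])
  then show ?case using pos
    by (auto intro!: positive_op.intro simp: inner_gram_Cons[OF x] simp del: gram.simps)
qed

lemma gram_append:
  "set xs \<subseteq> BG \<Longrightarrow> inner v (gram (xs @ ys) v) = inner v (gram xs v) + inner v (gram ys v)"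
  by (induction xs) (auto simp: inner_gram_Cons inner_gram_Nil simp del: gram.simps)

text \<open>The sum over a concatenation dominates both partial sums. Consequently the defects of
  such sums form a directed family.\<close>

lemma resolvent_gram_append:
  assumes "set xs \<subseteq> BG" "set ys \<subseteq> BG"
  shows "inner v (resolvent (gram (xs @ ys)) v) \<le> inner v (resolvent (gram xs) v)"
    and "inner v (resolvent (gram (xs @ ys)) v) \<le> inner v (resolvent (gram ys) v)"
proof -
  interpret xs: positive_op "gram xs" by (rule gram_positive) fact
  interpret ys: positive_op "gram ys" by (rule gram_positive) fact
  interpret b: positive_op "gram (xs @ ys)" using assms by (intro gram_positive) auto
  show "inner v (resolvent (gram (xs @ ys)) v) \<le> inner v (resolvent (gram xs) v)"
    "inner v (resolvent (gram (xs @ ys)) v) \<le> inner v (resolvent (gram ys) v)"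
    by (rule resolvent_antimono; unfold_locales; simp add: gram_append[OF assms(1)] xs.pos ys.pos)+
qed

text \<open>Positivity of \<open>T\<close> at \<open>v - T v\<close>, together with
  \<open>T \<le> 1\<close> at \<open>T v\<close>, shows that the square of \<open>T\<close> is at
  most \<open>T\<close>.\<close>

lemma norm_apply_le_inner:
  assumes sa: "self_adjoint T" and pos: "\<And>v. 0 \<le> inner v (T v)" and le: "\<And>v. inner v (T v) \<le> inner v v"
  shows "(norm (T v))\<^sup>2 \<le> inner v (T v)"
proof -
  have "0 \<le> inner (v - T v) (T (v - T v))" by (rule pos)
  also have "\<dots> = inner v (T v) - 2 * (norm (T v))\<^sup>2 + inner (T v) (T (T v))"
    using self_adjoint_inner[OF sa, of v "T v"]
    by (simp add: BG_diff[OF self_adjoint_BG[OF sa]] inner_diff_left inner_diff_right power2_norm_eq_inner)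
  also have "inner (T v) (T (T v)) \<le> (norm (T v))\<^sup>2" using le by (simp add: power2_norm_eq_inner)
  finally show ?thesis by linarith
qed

text \<open>For \<open>m \<le> n\<close> the difference \<open>T n - T m\<close> lies between 0 and
  1, so \<open>norm_apply_le_inner\<close> bounds its effect on \<open>v\<close> by the increment of
  a bounded increasing real sequence. Hence \<open>T n v\<close> is Cauchy.\<close>

lemma monotone_strong_limit:
  fixes T :: "nat \<Rightarrow> ('a::complex_hilbert) op"
  assumes sa: "\<And>n. self_adjoint (T n)" and pos: "\<And>n v. 0 \<le> inner v (T n v)"
    and le: "\<And>n v. inner v (T n v) \<le> inner v v"
    and mono: "\<And>n v. inner v (T n v) \<le> inner v (T (Suc n) v)"
  obtains S where "self_adjoint S" "\<And>v. (\<lambda>n. T n v) \<longlonglongrightarrow> S v"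
proof -
  note BG = self_adjoint_BG[OF sa]
  have inc: "inner v (T m v) \<le> inner v (T n v)" if "m \<le> n" for v m n
    using lift_Suc_mono_le[of "\<lambda>n. inner v (T n v)"] mono that by blast
  have bnd: "(norm (T n v - T m v))\<^sup>2 \<le> inner v (T n v) - inner v (T m v)" if "m \<le> n" for v m n
  proof -
    define D where "D = opadd (T n) (opscale (-1) (T m))"
    have D: "D v = T n v - T m v" for v by (simp add: D_def opadd_def opscale_def scaleC_minus_one)
    have "D \<in> BG" unfolding D_def by (intro opadd_BG opscale_BG BG)
    then have "self_adjoint D"
      using self_adjoint_inner[OF sa] by (simp add: self_adjoint_iff D inner_diff_left inner_diff_right)
    moreover have "0 \<le> inner v (D v)" for v using inc[OF that, of v] by (simp add: D inner_diff_right)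
    moreover have "inner v (D v) \<le> inner v v" for v
      using pos[of v m] le[of v n] by (simp add: D inner_diff_right)
    ultimately have "(norm (D v))\<^sup>2 \<le> inner v (D v)" by (rule norm_apply_le_inner)
    then show ?thesis by (simp add: D inner_diff_right)
  qed
  have "Cauchy (\<lambda>n. T n v)" for v
  proof (rule metric_CauchyI)
    fix e :: real assume "e > 0"
    have "incseq (\<lambda>n. inner v (T n v))" using inc by (simp add: incseq_def)
    then have "Cauchy (\<lambda>n. inner v (T n v))"
      using le by (metis incseq_convergent LIMSEQ_imp_Cauchy)
    then obtain N where N: "\<And>m n. m \<ge> N \<Longrightarrow> n \<ge> N \<Longrightarrow> dist (inner v (T m v)) (inner v (T n v)) < e\<^sup>2"
      using \<open>e > 0\<close> metric_CauchyD[of _ "e\<^sup>2"] by (metis zero_less_power)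
    have *: "dist (T n v) (T m v) < e" if "m \<ge> N" "m \<le> n" for m n
    proof -
      have "dist (inner v (T n v)) (inner v (T m v)) < e\<^sup>2" using N that by simp
      then have "(norm (T n v - T m v))\<^sup>2 < e\<^sup>2"
        using bnd[OF that(2), of v] unfolding dist_real_def by argo
      then show ?thesis using \<open>e > 0\<close> by (simp add: dist_norm power2_less_imp_less)
    qed
    have "dist (T n v) (T m v) < e" if "m \<ge> N" "n \<ge> N" for m n
      using *[of m n] *[of n m] that by (cases "m \<le> n") (auto simp: dist_commute)
    then show "\<exists>M. \<forall>m\<ge>M. \<forall>n\<ge>M. dist (T m v) (T n v) < e" by blast
  qed
  then have "\<exists>l. (\<lambda>n. T n v) \<longlonglongrightarrow> l" for v using Cauchy_convergent convergent_def by blast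
  then obtain S where S: "\<And>v. (\<lambda>n. T n v) \<longlonglongrightarrow> S v" by metis
  have contr: "norm (T n v) \<le> norm v" for n v
  proof -
    have "(norm (T n v))\<^sup>2 \<le> inner v (T n v)" using sa pos le by (rule norm_apply_le_inner)
    also have "\<dots> \<le> (norm v)\<^sup>2" using le by (simp add: power2_norm_eq_inner)
    finally show ?thesis by (rule power2_le_imp_le) simp
  qed
  have "S \<in> BG" unfolding BG_iff
  proof (intro conjI allI bounded_linear_intro[of _ 1])
    show "S (x + y) = S x + S y" for x y
      by (rule LIMSEQ_unique[OF S]) (simp add: BG_add[OF BG] tendsto_add S)
    show "S (r *\<^sub>R x) = r *\<^sub>R S x" for r x
      by (rule LIMSEQ_unique[OF S]) (simp add: BG_scaleR[OF BG] tendsto_scaleR S)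
    show "S (cJ x) = cJ (S x)" for x
      by (rule LIMSEQ_unique[OF S])
        (simp add: BG_cJ[OF BG] bounded_linear.tendsto[OF bounded_linear_cJ S])
    show "norm (S x) \<le> norm x * 1" for x
      using LIMSEQ_le_const2[OF tendsto_norm[OF S[of x]], of "norm x"] contr by auto
  qed
  moreover have "inner (S x) y = inner x (S y)" for x y
  proof (rule LIMSEQ_unique)
    show "(\<lambda>n. inner (T n x) y) \<longlonglongrightarrow> inner (S x) y" by (intro tendsto_intros S)
    show "(\<lambda>n. inner (T n x) y) \<longlonglongrightarrow> inner x (S y)"
      unfolding self_adjoint_inner[OF sa] by (intro tendsto_intros S)
  qed
  ultimately have "self_adjoint S" by (simp add: self_adjoint_iff)
  then show ?thesis using S that by blast
qed

subsection \<open>Normal representations\<close>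

text \<open>\<open>\<pi>\<close> may take any values in \<open>BG\<close> on the same space, so that
  \<open>\<theta>'\<close> on \<open>commutant B\<close> is an instance and intertwiners are again
  elements of \<open>BG\<close>.\<close>

locale normal_rep =
  fixes M :: "('a::complex_hilbert) op set" and \<pi> :: "'a op \<Rightarrow> 'a op"
  assumes vn: "von_neumann_algebra M" and hom: "star_hom M BG \<pi>" and normal: "normal_map M \<pi>"
begin

lemma M_BG: "x \<in> M \<Longrightarrow> x \<in> BG" and M_id: "id \<in> M"
  and M_add: "x \<in> M \<Longrightarrow> y \<in> M \<Longrightarrow> opadd x y \<in> M"
  and M_comp: "x \<in> M \<Longrightarrow> y \<in> M \<Longrightarrow> x \<circ> y \<in> M"
  and M_scale: "x \<in> M \<Longrightarrow> opscale c x \<in> M"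
  and M_adj: "x \<in> M \<Longrightarrow> adj x \<in> M"
  using vn unfolding von_neumann_algebra_def by auto

lemma M_bicommutant:
  assumes "T \<in> BG" "\<And>s. s \<in> commutant M \<Longrightarrow> s \<circ> T = T \<circ> s"
  shows "T \<in> M"
proof -
  have "T \<in> commutant (commutant M)" using assms by (subst commutant_def) auto
  then show ?thesis using vn by (simp add: von_neumann_algebra_def)
qed

text \<open>Commutation with a bounded \<open>s\<close> survives pointwise limits, so a bicommutant
  is closed under them.\<close>

lemma M_strong_limit:
  assumes "S \<in> BG" "\<And>n. T n \<in> M" "\<And>v. (\<lambda>n. T n v) \<longlonglongrightarrow> S v"
  shows "S \<in> M"
proof (rule M_bicommutant[OF assms(1)], rule ext)
  fix s v assume s: "s \<in> commutant M"
  then have "s \<in> BG" and "s (T n v) = T n (s v)" for n v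
    using assms(2)[of n] by (auto simp: commutant_def fun_eq_iff)
  then have "(\<lambda>n. T n (s v)) \<longlonglongrightarrow> s (S v)"
    using bounded_linear.tendsto[OF BG_bounded_linear assms(3), of s v] by simp
  from LIMSEQ_unique[OF this assms(3)] show "(s \<circ> S) v = (S \<circ> s) v" by simp
qed

lemma op_compl_M: "T \<in> M \<Longrightarrow> op_compl T \<in> M"
  unfolding op_compl_def by (intro M_add M_scale M_id)

lemma gram_M: "set xs \<subseteq> M \<Longrightarrow> gram xs \<in> M"
  by (induction xs) (auto intro: M_add M_comp M_adj M_id M_scale)

lemma gram_positive_op: "set xs \<subseteq> M \<Longrightarrow> positive_op (gram xs)"
  using M_BG by (auto intro: gram_positive)

lemma resolvent_gram_M:
  assumes "set xs \<subseteq> M"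
  shows "resolvent (gram xs) \<in> M"
proof -
  interpret positive_op "gram xs" by (rule gram_positive_op) fact
  show ?thesis
  proof (rule M_bicommutant[OF resolvent_BG])
    fix s assume "s \<in> commutant M"
    then show "s \<circ> resolvent (gram xs) = resolvent (gram xs) \<circ> s"
      using gram_M[OF assms] by (intro resolvent_commute) (auto simp: commutant_def)
  qed
qed

lemma defect_gram_M: "set xs \<subseteq> M \<Longrightarrow> defect (gram xs) \<in> M"
  unfolding defect_def by (intro op_compl_M resolvent_gram_M)

lemma pi_BG: "x \<in> M \<Longrightarrow> \<pi> x \<in> BG" and pi_id: "\<pi> id = id"
  and pi_add: "x \<in> M \<Longrightarrow> y \<in> M \<Longrightarrow> \<pi> (opadd x y) = opadd (\<pi> x) (\<pi> y)"
  and pi_comp: "x \<in> M \<Longrightarrow> y \<in> M \<Longrightarrow> \<pi> (x \<circ> y) = \<pi> x \<circ> \<pi> y"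
  and pi_scale: "x \<in> M \<Longrightarrow> \<pi> (opscale c x) = opscale c (\<pi> x)"
  and pi_adj: "x \<in> M \<Longrightarrow> \<pi> (adj x) = adj (\<pi> x)"
  using hom unfolding star_hom_def by auto

lemma pi_sa: "x \<in> M \<Longrightarrow> self_adjoint x \<Longrightarrow> self_adjoint (\<pi> x)"
  unfolding self_adjoint_def using pi_adj pi_BG by metis

text \<open>Normality contains monotonicity: \<open>b\<close> is the supremum of \<open>{a, b}\<close> if \<open>a \<le> b\<close>.\<close>

lemma pi_mono:
  assumes "a \<in> M" "b \<in> M" "self_adjoint a" "self_adjoint b" "op_le a b"
  shows "op_le (\<pi> a) (\<pi> b)"
proof -
  have "is_sa_lub {a, b} b" using assms by (auto simp: is_sa_lub_def op_le_def)
  moreover have "op_le x x" for x :: "'a op" by (simp add: op_le_def)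
  ultimately have "is_sa_lub (\<pi> ` {a, b}) (\<pi> b)" using assms
    by (intro normal[unfolded normal_map_def, rule_format, of "{a, b}" b]) auto
  then show ?thesis by (auto simp: is_sa_lub_def)
qed

lemma pi_pos:
  assumes "a \<in> M" "self_adjoint a" "\<And>v. 0 \<le> inner v (a v)"
  shows "0 \<le> inner v (\<pi> a v)"
proof -
  have "op_le (\<pi> (opscale 0 id)) (\<pi> a)"
  proof (rule pi_mono)
    show "self_adjoint (opscale 0 id :: 'a op)"
      by (auto simp: self_adjoint_iff opscale_BG id_BG) (simp add: opscale_def scaleC_zero)
    show "op_le (opscale 0 id) a" using assms(3) by (simp add: op_le_def opscale_def scaleC_zero)
  qed (use assms M_id M_scale in auto)
  then show ?thesis by (simp add: op_le_def pi_scale[OF M_id] opscale_zero_apply)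
qed

lemma pi_le_id:
  assumes "a \<in> M" "self_adjoint a" "\<And>v. inner v (a v) \<le> inner v v"
  shows "inner v (\<pi> a v) \<le> inner v v"
  using pi_mono[OF assms(1) M_id assms(2) self_adjoint_id] assms(3) by (simp add: op_le_def pi_id)

text \<open>With \<open>p\<close> the projection onto the complex line of \<open>\<xi>\<close>, each \<open>\<pi> d\<close> is bounded by
  \<open>2 (1 - p) + 2 (\<epsilon> / \<parallel>\<xi>\<parallel>\<^sup>2) p\<close>, hence so is \<open>\<pi> s\<close>.\<close>

lemma normal_bound:
  assumes D: "D \<subseteq> M" "D \<noteq> {}" "\<And>d. d \<in> D \<Longrightarrow> self_adjoint d"
    and dir: "\<And>a b. a \<in> D \<Longrightarrow> b \<in> D \<Longrightarrow> \<exists>c\<in>D. op_le a c \<and> op_le b c"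
    and pos: "\<And>d v. d \<in> D \<Longrightarrow> 0 \<le> inner v (d v)" and le: "\<And>d v. d \<in> D \<Longrightarrow> inner v (d v) \<le> inner v v"
    and lub: "is_sa_lub D s" and eps: "\<And>d. d \<in> D \<Longrightarrow> inner \<xi> (\<pi> d \<xi>) \<le> \<epsilon>"
    and xi: "\<xi> \<noteq> 0"
  shows "inner \<xi> (\<pi> s \<xi>) \<le> 2 * \<epsilon>"
proof -
  define h where "h = inner \<xi> \<xi>"
  have h: "h > 0" using xi by (simp add: h_def)
  \<comment> \<open>In real terms the complex line is spanned by the orthogonal vectors
    \<open>\<xi>\<close> and \<open>cJ \<xi>\<close>, which have equal norm.\<close>
  define p where "p v = (inner \<xi> v / h) *\<^sub>R \<xi> + (inner (cJ \<xi>) v / h) *\<^sub>R cJ \<xi>" for v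
  have blp: "bounded_linear p" unfolding p_def
    by (intro bounded_linear_add bounded_linear_compose[OF bounded_linear_scaleR_left]
        bounded_linear_compose[OF bounded_linear_divide] bounded_linear_inner_right)
  have pJ: "p (cJ v) = cJ (p v)" for v
    by (simp add: p_def cJ_add cJ_diff cJ_scaleR cJ_cJ inner_cJ inner_cJ_left)
  define t where "t v = 2 *\<^sub>R (v - p v) + (2 * \<epsilon> / h) *\<^sub>R p v" for v
  have blt: "bounded_linear t" unfolding t_def
    by (intro bounded_linear_add bounded_linear_sub bounded_linear_const_scaleR blp bounded_linear_ident)
  have psa: "inner (p x) y = inner x (p y)" for x y
    by (simp add: p_def inner_add_left inner_add_right inner_commute mult.commute)
  have sat: "self_adjoint t" unfolding self_adjoint_iff BG_iff
    using blt by (auto simp: t_def pJ cJ_add cJ_diff cJ_scaleR inner_add_left inner_add_right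
        inner_diff_left inner_diff_right psa)
  have hJ: "inner (cJ \<xi>) (cJ \<xi>) = h" "inner \<xi> (cJ \<xi>) = 0" "inner (cJ \<xi>) \<xi> = 0"
    by (auto simp: h_def inner_cJ inner_cJ_self inner_commute[of "cJ \<xi>"])
  have pxi: "p \<xi> = \<xi>" "p (cJ \<xi>) = cJ \<xi>" using h by (auto simp: p_def hJ h_def[symmetric])
  have pp: "p (p v) = p v" for v
  proof -
    interpret bounded_linear p by (rule blp)
    show ?thesis by (subst (2) p_def) (simp add: add scaleR pxi, simp add: p_def)
  qed
  have "op_le (\<pi> d) t" if d: "d \<in> D" for d
    unfolding op_le_def
  proof
    fix v
    have dM: "d \<in> M" and dsa: "self_adjoint d" using D d by auto
    have P: "self_adjoint (\<pi> d)" using pi_sa[OF dM dsa] .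
    note PB = self_adjoint_BG[OF P]
    have Ppos: "0 \<le> inner v (\<pi> d v)" and Ple: "inner v (\<pi> d v) \<le> inner v v" for v
      using pi_pos[OF dM dsa pos[OF d]] pi_le_id[OF dM dsa le[OF d]] by auto
    define a b where "a = v - p v" and "b = p v"
    have v: "v = a + b" by (simp add: a_def b_def)
    \<comment> \<open>The imaginary part of the diagonal entry of a self-adjoint operator vanishes;
      on the line the form of \<open>\<pi> d\<close> is therefore a multiple of its value at
      \<open>\<xi>\<close>.\<close>
    have cross: "inner \<xi> (cJ (\<pi> d \<xi>)) = 0"
    proof -
      have "inner \<xi> (cJ (\<pi> d \<xi>)) = inner (\<pi> d \<xi>) (cJ \<xi>)"
        using self_adjoint_inner[OF P, of \<xi> "cJ \<xi>"] by (simp add: BG_cJ[OF PB])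
      also have "\<dots> = - inner \<xi> (cJ (\<pi> d \<xi>))"
        using inner_cJ_left[of \<xi> "\<pi> d \<xi>"] by (simp add: inner_commute)
      finally show ?thesis by simp
    qed
    define \<alpha> \<beta> where "\<alpha> = inner \<xi> v / h" and "\<beta> = inner (cJ \<xi>) v / h"
    have b: "b = \<alpha> *\<^sub>R \<xi> + \<beta> *\<^sub>R cJ \<xi>" by (simp add: b_def p_def \<alpha>_def \<beta>_def)
    have bb: "inner b b = (\<alpha>\<^sup>2 + \<beta>\<^sup>2) * h"
      by (simp add: b inner_add_left inner_add_right hJ power2_eq_square algebra_simps flip: h_def)
    have "inner b (\<pi> d b) = (\<alpha>\<^sup>2 + \<beta>\<^sup>2) * inner \<xi> (\<pi> d \<xi>)"
      by (simp add: b BG_add[OF PB] BG_scaleR[OF PB] BG_cJ[OF PB] inner_add_left inner_add_right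
          inner_cJ inner_cJ_left cJ_cJ cross power2_eq_square algebra_simps)
    also have "\<dots> \<le> (\<alpha>\<^sup>2 + \<beta>\<^sup>2) * \<epsilon>" by (intro mult_left_mono eps d) simp
    also have "\<dots> = inner b b * \<epsilon> / h" using h by (simp add: bb)
    finally have 1: "inner b (\<pi> d b) \<le> inner b b * \<epsilon> / h" .
    have ab: "inner a b = 0" "inner b a = 0"
      using psa[of v v] psa[of v "p v"] by (auto simp: a_def b_def inner_diff_left inner_diff_right pp)
    have pab: "p v = b" "v - b = a" by (auto simp: a_def b_def)
    \<comment> \<open>Positivity at \<open>a - b\<close> absorbs the cross terms between
      \<open>a\<close> and \<open>b\<close>; this costs the factor 2.\<close>
    have "0 \<le> inner (a - b) (\<pi> d (a - b))" by (rule Ppos)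
    then have "inner v (\<pi> d v) \<le> 2 * inner a (\<pi> d a) + 2 * inner b (\<pi> d b)"
      unfolding v by (simp add: BG_diff[OF PB] BG_add[OF PB] inner_diff_left inner_diff_right
          inner_add_left inner_add_right)
    also have "\<dots> \<le> 2 * inner a a + 2 * (inner b b * \<epsilon> / h)" using 1 Ple[of a] by simp
    also have "\<dots> = inner v (t v)"
      unfolding t_def pab by (simp add: v inner_add_left inner_add_right ab)
    finally show "inner v (\<pi> d v) \<le> inner v (t v)" .
  qed
  \<comment> \<open>Normality makes \<open>\<pi> s\<close> the least upper bound of the images,
    hence at most their upper bound \<open>t\<close>.\<close>
  moreover have "is_sa_lub (\<pi> ` D) (\<pi> s)"
    using D dir lub by (intro normal[unfolded normal_map_def, rule_format, of D s]) auto
  ultimately have "op_le (\<pi> s) t" using sat by (auto simp: is_sa_lub_def)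
  then have "inner \<xi> (\<pi> s \<xi>) \<le> inner \<xi> (t \<xi>)" by (simp add: op_le_def)
  also have "\<dots> = 2 * \<epsilon>" using h by (simp add: t_def pxi flip: h_def)
  finally show ?thesis .
qed

lemma inner_pi_gram:
  "set xs \<subseteq> M \<Longrightarrow> inner v (\<pi> (gram xs) v) = (\<Sum>x\<leftarrow>xs. (norm (\<pi> x v))\<^sup>2)"
proof (induction xs)
  case Nil
  show ?case unfolding gram.simps pi_scale[OF M_id] by (simp add: opscale_zero_apply)
next
  case (Cons x xs)
  then have "x \<in> M" "set xs \<subseteq> M" by simp_all
  then show ?case using Cons.IH
    by (simp add: pi_add pi_comp pi_adj M_comp M_adj gram_M)
      (simp add: opadd_apply inner_add_right inner_adj[OF pi_BG, symmetric] power2_norm_eq_inner)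
qed

text \<open>If the left ideal annihilating \<open>\<xi>\<close> has trivial common kernel, then its elements
  \<open>S / (1 + S)\<close> increase to \<open>id\<close>, and normality gives \<open>\<xi> = \<pi> id \<xi> = 0\<close>.\<close>

lemma annihilator_kernel:
  assumes ann: "\<And>\<eta>. \<eta> \<noteq> 0 \<Longrightarrow> \<exists>c\<in>M. \<pi> c \<xi> = 0 \<and> c \<eta> \<noteq> 0"
  shows "\<xi> = 0"
proof (rule ccontr)
  assume xi: "\<xi> \<noteq> 0"
  define N where "N = {x \<in> M. \<pi> x \<xi> = 0}"
  have NM: "x \<in> M" if "x \<in> N" for x using that by (simp add: N_def)
  have NB: "x \<in> BG" if "x \<in> N" for x using NM[OF that] M_BG by blast
  have po: "positive_op (gram xs)" if "set xs \<subseteq> N" for xs using that NB by (auto intro: gram_positive)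
  \<comment> \<open>\<open>V\<close> consists of the vectors on which the defects come arbitrarily
    close to the identity. The aim is \<open>V = UNIV\<close>.\<close>
  define V where "V = {v. \<forall>e>0. \<exists>xs. set xs \<subseteq> N \<and> inner v (resolvent (gram xs) v) < e}"
  have sum: "inner (v + w) (resolvent S (v + w)) \<le> 2 * inner v (resolvent S v) + 2 * inner w (resolvent S w)"
    if "positive_op S" for v w S
  proof -
    interpret positive_op S by fact
    have "0 \<le> inner (v - w) (resolvent S (v - w))" by (rule resolvent_ge)
    then show ?thesis by (simp add: BG_diff[OF resolvent_BG] BG_add[OF resolvent_BG] inner_diff_left inner_diff_right
          inner_add_left inner_add_right)
  qed
  have "subspace V"
  proof (rule subspaceI)
    show "0 \<in> V" by (auto simp: V_def intro: exI[of _ "[]"])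
    fix v w assume v: "v \<in> V" and w: "w \<in> V"
    show "v + w \<in> V" unfolding V_def
    proof (intro CollectI allI impI)
      fix e :: real assume "e > 0"
      then obtain xs ys where xs: "set xs \<subseteq> N" "inner v (resolvent (gram xs) v) < e / 4"
        and ys: "set ys \<subseteq> N" "inner w (resolvent (gram ys) w) < e / 4"
        using v w unfolding V_def mem_Collect_eq by (metis divide_pos_pos zero_less_numeral)
      let ?R = "resolvent (gram (xs @ ys))"
      have "inner (v + w) (?R (v + w)) \<le> 2 * inner v (?R v) + 2 * inner w (?R w)"
        using xs ys by (intro sum po) auto
      moreover have "inner v (?R v) \<le> inner v (resolvent (gram xs) v)"
        "inner w (?R w) \<le> inner w (resolvent (gram ys) w)"
        using xs(1) ys(1) NB by (auto intro!: resolvent_gram_append)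
      ultimately show "\<exists>xs. set xs \<subseteq> N \<and> inner (v + w) (resolvent (gram xs) (v + w)) < e"
        using xs ys by (intro exI[of _ "xs @ ys"]) auto
    qed
  next
    fix c :: real and v assume v: "v \<in> V"
    show "c *\<^sub>R v \<in> V" unfolding V_def
    proof (intro CollectI allI impI)
      fix e :: real assume "e > 0"
      \<comment> \<open>The divisor \<open>c\<^sup>2 + 1\<close> also covers
        \<open>c = 0\<close>.\<close>
      then have e: "e / (c\<^sup>2 + 1) > 0" by (simp add: add_nonneg_pos)
      then obtain xs where xs: "set xs \<subseteq> N" "inner v (resolvent (gram xs) v) < e / (c\<^sup>2 + 1)"
        using v unfolding V_def by blast
      interpret positive_op "gram xs" by (rule po) fact
      have "inner (c *\<^sub>R v) (resolvent (gram xs) (c *\<^sub>R v)) = c\<^sup>2 * inner v (resolvent (gram xs) v)"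
        by (simp add: BG_scaleR[OF resolvent_BG] power2_eq_square)
      also have "\<dots> \<le> c\<^sup>2 * (e / (c\<^sup>2 + 1))" using xs by (intro mult_left_mono) auto
      also have "\<dots> < e"
      proof -
        have "c\<^sup>2 * e < e * (c\<^sup>2 + 1)" using \<open>e > 0\<close> by (simp add: algebra_simps)
        then show ?thesis by (simp add: pos_divide_less_eq add_nonneg_pos)
      qed
      finally show "\<exists>xs. set xs \<subseteq> N \<and> inner (c *\<^sub>R v) (resolvent (gram xs) (c *\<^sub>R v)) < e"
        using xs by blast
    qed
  qed
  moreover have "closed V"
  proof (rule closed_sequential_limits[THEN iffD2], intro allI impI, elim conjE)
    fix f l assume f: "\<forall>n. f n \<in> V" "f \<longlonglongrightarrow> l"
    show "l \<in> V" unfolding V_def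
    proof (intro CollectI allI impI)
      fix e :: real assume "e > 0"
      then have e: "sqrt (e / 4) > 0" "e / 4 > 0" by simp_all
      from LIMSEQ_D[OF f(2) e(1)] obtain n where "norm (f n - l) < sqrt (e / 4)" by blast
      then have "(norm (l - f n))\<^sup>2 < (sqrt (e / 4))\<^sup>2"
        by (intro power_strict_mono) (simp_all add: norm_minus_commute)
      then have n': "(norm (l - f n))\<^sup>2 < e / 4" using e(2) by simp
      have "f n \<in> V" using f(1) by blast
      then obtain xs where xs: "set xs \<subseteq> N" "inner (f n) (resolvent (gram xs) (f n)) < e / 4"
        using e(2) unfolding V_def by blast
      interpret positive_op "gram xs" by (rule po) fact
      have "inner (f n + (l - f n)) (resolvent (gram xs) (f n + (l - f n)))
        \<le> 2 * inner (f n) (resolvent (gram xs) (f n)) + 2 * inner (l - f n) (resolvent (gram xs) (l - f n))"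
        by (rule sum[OF po[OF xs(1)]])
      moreover have "inner (l - f n) (resolvent (gram xs) (l - f n)) \<le> (norm (l - f n))\<^sup>2"
        using resolvent_le by (simp add: power2_norm_eq_inner)
      ultimately have "inner l (resolvent (gram xs) l) < e"
        using n' xs(2) by (simp del: inner_diff_left)
      then show "\<exists>xs. set xs \<subseteq> N \<and> inner l (resolvent (gram xs) l) < e" using xs by blast
    qed
  qed
  \<comment> \<open>Scaling \<open>x\<close> by a large factor stays in \<open>N\<close> and makes
    the resolvent form at \<open>adj x w\<close> as small as desired.\<close>
  moreover have adjV: "adj x w \<in> V" if x: "x \<in> N" for x w
    unfolding V_def
  proof (intro CollectI allI impI)
    fix e :: real assume "e > 0"
    \<comment> \<open>Chosen so that \<open>(norm w)\<^sup>2 / s < e\<close>.\<close>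
    define s where "s = (norm w)\<^sup>2 / e + 1"
    have s: "s > 0" using \<open>e > 0\<close> by (simp add: s_def add_nonneg_pos)
    define y where "y = opscale (complex_of_real (sqrt s)) x"
    have y: "y v = sqrt s *\<^sub>R x v" for v by (simp add: y_def opscale_def scaleC_def)
    have yN: "y \<in> N" using x M_scale by (simp add: N_def y_def pi_scale) (simp add: opscale_def scaleC_def cJ_zero)
    interpret positive_op "gram [y]" using yN by (intro po) auto
    define u where "u = resolvent (gram [y]) (adj x w)"
    have "inner (adj x w) u = inner u u + inner u (gram [y] u)"
      unfolding u_def by (rule resolvent_inner)
    also have "inner u (gram [y] u) = s * (norm (x u))\<^sup>2"
      using s by (simp add: inner_gram_Cons[OF NB[OF yN]] inner_gram_Nil y power2_norm_eq_inner del: gram.simps)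
    finally have u: "inner w (x u) = inner u u + s * (norm (x u))\<^sup>2"
      by (simp add: inner_adj'[OF NB[OF x]])
    then have "s * (norm (x u))\<^sup>2 \<le> inner w (x u)" by simp
    also have "\<dots> \<le> norm w * norm (x u)" by (rule norm_cauchy_schwarz)
    finally have "s * norm (x u) \<le> norm w" by (cases "x u = 0") (auto simp: power2_eq_square)
    then have "norm (x u) \<le> norm w / s" using s by (simp add: pos_le_divide_eq mult.commute)
    then have "inner w (x u) \<le> norm w * (norm w / s)"
      by (meson mult_left_mono norm_cauchy_schwarz norm_ge_zero order_trans)
    also have "\<dots> < e" using s \<open>e > 0\<close>
      by (simp add: pos_divide_less_eq) (simp add: s_def algebra_simps power2_eq_square)
    finally have "inner (adj x w) u < e" by (simp add: inner_adj'[OF NB[OF x]])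
    then show "\<exists>xs. set xs \<subseteq> N \<and> inner (adj x w) (resolvent (gram xs) (adj x w)) < e"
      using yN by (intro exI[of _ "[y]"]) (simp add: u_def)
  qed
  \<comment> \<open>A vector orthogonal to \<open>V\<close> is orthogonal to all ranges of
    \<open>adj x\<close>, hence killed by every \<open>x\<close> in \<open>N\<close>, hence zero by
    the hypothesis.\<close>
  ultimately have V: "V = UNIV"
  proof (intro subspace_eq_UNIV)
    fix \<eta> assume ker: "\<And>k. k \<in> V \<Longrightarrow> inner \<eta> k = 0"
    have "x \<eta> = 0" if "x \<in> N" for x
    proof -
      have "inner \<eta> (adj x (x \<eta>)) = 0" by (rule ker[OF adjV[OF that]])
      then show ?thesis by (simp add: inner_adj[OF NB[OF that], symmetric])
    qed
    then show "\<eta> = 0" using ann[of \<eta>] by (auto simp: N_def)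
  qed
  define D where "D = (\<lambda>xs. defect (gram xs)) ` {xs. set xs \<subseteq> N}"
  \<comment> \<open>\<open>normal_bound\<close> applies with \<epsilon> = 0: each defect is
    dominated by a sum of squares of elements annihilating \<open>\<xi>\<close>.\<close>
  have "inner \<xi> (\<pi> id \<xi>) \<le> 2 * 0"
  proof (rule normal_bound[of D])
    show "D \<subseteq> M" using defect_gram_M NM by (auto simp: D_def)
    show "D \<noteq> {}" unfolding D_def by (auto intro: exI[of _ "[]"])
    show "self_adjoint d" "0 \<le> inner v (d v)" "inner v (d v) \<le> inner v v" if "d \<in> D" for d v
      using that positive_op.defect_sa[OF po] positive_op.defect_ge[OF po] positive_op.defect_le_id[OF po]
      by (auto simp: D_def)
    show "\<exists>c\<in>D. op_le a c \<and> op_le b c" if "a \<in> D" "b \<in> D" for a b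
    proof -
      obtain xs ys where xs: "set xs \<subseteq> N" "a = defect (gram xs)" and ys: "set ys \<subseteq> N" "b = defect (gram ys)"
        using \<open>a \<in> D\<close> \<open>b \<in> D\<close> by (auto simp: D_def)
      have "set xs \<subseteq> BG" "set ys \<subseteq> BG" using xs(1) ys(1) NB by auto
      then have "op_le a (defect (gram (xs @ ys)))" "op_le b (defect (gram (xs @ ys)))"
        using resolvent_gram_append[of xs ys]
        by (auto simp: op_le_def xs ys defect_apply inner_diff_right)
      moreover have "defect (gram (xs @ ys)) \<in> D" using xs ys by (auto simp: D_def)
      ultimately show ?thesis by blast
    qed
    show "is_sa_lub D id" unfolding is_sa_lub_def
    proof (intro conjI allI impI ballI)
      show "op_le d id" if "d \<in> D" for d
        using that positive_op.defect_le_id[OF po] by (auto simp: D_def op_le_def)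
      fix t assume t: "self_adjoint t \<and> (\<forall>d\<in>D. op_le d t)"
      show "op_le id t" unfolding op_le_def
      proof
        fix v
        show "inner v (id v) \<le> inner v (t v)"
        proof (rule field_le_epsilon)
          fix e :: real assume "e > 0"
          then obtain xs where xs: "set xs \<subseteq> N" "inner v (resolvent (gram xs) v) < e"
            using V unfolding V_def by blast
          have "inner v (defect (gram xs) v) \<le> inner v (t v)"
            using t xs(1) by (auto simp: D_def op_le_def)
          then show "inner v (id v) \<le> inner v (t v) + e"
            using xs(2) by (simp add: defect_apply inner_diff_right)
        qed
      qed
    qed (rule self_adjoint_id)
    show "inner \<xi> (\<pi> d \<xi>) \<le> 0" if dD: "d \<in> D" for d
    proof -
      obtain xs where xs: "set xs \<subseteq> N" "d = defect (gram xs)" using dD by (auto simp: D_def)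
      have xsM: "set xs \<subseteq> M" using xs NM by auto
      have d: "d \<in> M" "self_adjoint d" using xs(2) defect_gram_M[OF xsM] positive_op.defect_sa[OF po[OF xs(1)]] by auto
      have g: "self_adjoint (gram xs)" using po[OF xs(1)] by (simp add: positive_op_def)
      have "op_le d (gram xs)" using positive_op.defect_le[OF po[OF xs(1)]] by (simp add: op_le_def xs)
      then have "inner \<xi> (\<pi> d \<xi>) \<le> inner \<xi> (\<pi> (gram xs) \<xi>)"
        using pi_mono[OF d(1) gram_M[OF xsM] d(2) g] by (simp add: op_le_def)
      also have "\<dots> = (\<Sum>x\<leftarrow>xs. 0)"
        unfolding inner_pi_gram[OF xsM] using xs(1) by (intro arg_cong[of _ _ sum_list] map_cong) (auto simp: N_def)
      also have "\<dots> = 0" by simp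
      finally show ?thesis .
    qed
  qed (rule xi)
  then have "inner \<xi> \<xi> \<le> 0" by (simp add: pi_id)
  then show False using xi by (metis inner_gt_zero_iff not_less)
qed

end

section \<open>Auxiliary facts on closures, self-adjoint combinations and geometric sums\<close>

lemma subspace_closure:
  fixes S :: "'b::real_normed_vector set"
  assumes "subspace S"
  shows "subspace (closure S)"
proof (rule subspaceI)
  show "0 \<in> closure S" using subspace_0[OF assms] closure_subset by blast
next
  fix x y assume "x \<in> closure S" "y \<in> closure S"
  then obtain f g where f: "\<And>n. f n \<in> S" "f \<longlonglongrightarrow> x" and g: "\<And>n. g n \<in> S" "g \<longlonglongrightarrow> y"
    unfolding closure_sequential by blast
  have "(\<lambda>n. f n + g n) \<longlonglongrightarrow> x + y" by (intro tendsto_intros f g)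
  moreover have "f n + g n \<in> S" for n using f g subspace_add[OF assms] by blast
  ultimately show "x + y \<in> closure S" unfolding closure_sequential by (intro exI conjI allI)
next
  fix c :: real and x assume "x \<in> closure S"
  then obtain f where f: "\<And>n. f n \<in> S" "f \<longlonglongrightarrow> x" unfolding closure_sequential by blast
  have "(\<lambda>n. c *\<^sub>R f n) \<longlonglongrightarrow> c *\<^sub>R x" by (intro tendsto_intros f)
  moreover have "c *\<^sub>R f n \<in> S" for n using f subspace_scale[OF assms] by blast
  ultimately show "c *\<^sub>R x \<in> closure S" unfolding closure_sequential by (intro exI conjI allI)
qed

lemma closure_invariant:
  assumes "bounded_linear T" "\<And>x. x \<in> S \<Longrightarrow> T x \<in> closure S'" "x \<in> closure S"
  shows "T x \<in> closure S'"
  using image_closure_subset[of S T "closure S'"] bounded_linear.continuous_on[OF assms(1) continuous_on_id]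
    assms(2,3) by auto

lemma inner_zero_closure:
  assumes "\<And>x. x \<in> S \<Longrightarrow> inner a x = 0" "x \<in> closure S"
  shows "inner a x = 0"
proof -
  have "closed {x. inner a x = 0}" by (intro closed_Collect_eq continuous_intros)
  then show ?thesis using closure_minimal[of S "{x. inner a x = 0}"] assms by auto
qed

lemma opadd_sa: "self_adjoint x \<Longrightarrow> self_adjoint y \<Longrightarrow> self_adjoint (opadd x y)"
  by (auto simp: self_adjoint_iff opadd_BG) (simp add: opadd_def inner_add_left inner_add_right)

lemma opscale_real_apply: "opscale (complex_of_real r) T v = r *\<^sub>R T v"
  by (simp add: opscale_def scaleC_def)

lemma opscale_real_sa: "self_adjoint x \<Longrightarrow> self_adjoint (opscale (complex_of_real r) x)"
  by (auto simp: self_adjoint_iff opscale_BG opscale_real_apply)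

lemma opscale_i_id: "opscale \<i> id v = cJ v"
  by (simp add: opscale_def scaleC_def)

text \<open>Self-adjointness of \<open>x\<close> is essential: otherwise \<open>x \<eta> \<approx> \<eta>\<close> does not control \<open>x\<^sup>* x \<eta>\<close>.\<close>

lemma resolvent_square_bound:
  assumes x: "self_adjoint x" and close: "norm (x \<eta> - \<eta>) \<le> norm \<eta> / 8"
  shows "inner \<eta> (resolvent (gram [x]) \<eta>) \<le> 5/8 * inner \<eta> \<eta>"
proof -
  note xB = self_adjoint_BG[OF x]
  interpret positive_op "gram [x]" using xB by (intro gram_positive) simp
  define u where "u = resolvent (gram [x]) \<eta>"
  define A where "A = inner \<eta> u"
  have A: "A = inner u u + inner (x u) (x u)"
    unfolding A_def u_def resolvent_inner
    by (simp add: inner_gram_Cons[OF xB] inner_gram_Nil del: gram.simps)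
  have "norm u \<le> norm \<eta>" using norm_le[of u] by (simp add: u_def resolvent_right del: gram.simps)
  \<comment> \<open>Self-adjointness moves \<open>x\<close> from \<open>u\<close> to
    \<open>\<eta>\<close>. The first term of the difference is at most \<open>A\<close> plus half of
    \<open>inner \<eta> \<eta>\<close> by the next two steps, the error at most an eighth; 1/2 + 1/8
    = 5/8.\<close>
  have 1: "2 * A = inner (u + x u) \<eta> - inner u (x \<eta> - \<eta>)"
    using self_adjoint_inner[OF x, of u \<eta>]
    by (simp add: A_def inner_add_left inner_diff_right inner_commute[of \<eta> u])
  have 2: "2 * inner (u + x u) \<eta> \<le> inner (u + x u) (u + x u) + inner \<eta> \<eta>"
    using inner_ge_zero[of "u + x u - \<eta>"]
    by (simp add: inner_diff_left inner_diff_right inner_add_left inner_add_right inner_commute)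
  have 3: "inner (u + x u) (u + x u) \<le> 2 * A"
    using inner_ge_zero[of "u - x u"]
    by (simp add: A inner_diff_left inner_diff_right inner_add_left inner_add_right inner_commute)
  have "- inner u (x \<eta> - \<eta>) \<le> norm u * norm (x \<eta> - \<eta>)"
    by (metis abs_le_D2 Cauchy_Schwarz_ineq2)
  also have "\<dots> \<le> norm \<eta> * (norm \<eta> / 8)"
    using \<open>norm u \<le> norm \<eta>\<close> close by (intro mult_mono) auto
  also have "\<dots> = inner \<eta> \<eta> / 8" by (simp add: power2_norm_eq_inner[symmetric] power2_eq_square)
  finally have "A \<le> 5/8 * inner \<eta> \<eta>" using 1 2 3 by linarith
  then show ?thesis by (simp add: A_def u_def del: gram.simps)
qed

lemma halves_sum_list: "(\<Sum>n\<leftarrow>[N..<m]. (1/2::real) ^ n) \<le> 2 * (1/2) ^ N"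
proof -
  \<comment> \<open>The deficit \<open>2 * (1/2) ^ m\<close> makes the induction go through.\<close>
  have "(\<Sum>n\<leftarrow>[N..<m]. (1/2::real) ^ n) \<le> 2 * (1/2) ^ N - 2 * (1/2) ^ m" if "N \<le> m" for m
    using that by (induction m rule: dec_induct) simp_all
  from this[of m] show ?thesis by (cases "N \<le> m") (auto intro: order_trans)
qed

section \<open>Intertwiners with the identity representation and annihilating elements\<close>

context normal_rep
begin

lemma pi_opadd_apply: "x \<in> M \<Longrightarrow> y \<in> M \<Longrightarrow> \<pi> (opadd x y) v = \<pi> x v + \<pi> y v"
  unfolding pi_add by (rule opadd_apply)

lemma pi_opscale_real_apply: "x \<in> M \<Longrightarrow> \<pi> (opscale (complex_of_real r) x) v = r *\<^sub>R \<pi> x v"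
  unfolding pi_scale by (rule opscale_real_apply)

text \<open>The range of an intertwiner is invariant under \<open>\<pi>\<close>, so orthogonality to
  \<open>\<xi>\<close> spreads to the closed cyclic subspace that \<open>\<xi>\<close>
  generates.\<close>

lemma intertwiner_orthogonal:
  assumes y: "\<And>m. m \<in> M \<Longrightarrow> \<pi> m \<circ> y = y \<circ> m" and orth: "\<And>v. inner (y v) \<xi> = 0"
    and k: "k \<in> closure {\<pi> m \<xi> |m. m \<in> M}"
  shows "inner (y v) k = 0"
proof (rule inner_zero_closure[OF _ k])
  fix k assume "k \<in> {\<pi> m \<xi> |m. m \<in> M}"
  then obtain m where m: "m \<in> M" "k = \<pi> m \<xi>" by blast
  have "inner (y v) k = inner (\<pi> (adj m) (y v)) \<xi>" by (simp add: m inner_adj'[OF pi_BG] pi_adj)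
  also have "\<dots> = inner (y (adj m v)) \<xi>" using y[OF M_adj[OF m(1)]] by (simp add: fun_eq_iff)
  also have "\<dots> = 0" by (rule orth)
  finally show "inner (y v) k = 0" .
qed

text \<open>The nesting of pairs lets \<open>fst\<close> select the two copies of the identity
  representation and \<open>snd\<close> the two copies of \<open>\<pi>\<close>.\<close>

definition amplify :: "'a op \<Rightarrow> ('a \<times> 'a) \<times> 'a \<times> 'a \<Rightarrow> ('a \<times> 'a) \<times> 'a \<times> 'a" where
  "amplify m z = ((m (fst (fst z)), m (snd (fst z))), (\<pi> m (fst (snd z)), \<pi> m (snd (snd z))))"

lemma bounded_linear_amplify:
  assumes m: "m \<in> M"
  shows "bounded_linear (amplify m)"
proof -
  note fst = bounded_linear_fst and snd = bounded_linear_snd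
  note ff = bounded_linear_compose[OF fst fst] and sf = bounded_linear_compose[OF snd fst]
    and fs = bounded_linear_compose[OF fst snd] and ss = bounded_linear_compose[OF snd snd]
  note bm = BG_bounded_linear[OF M_BG[OF m]] and bp = BG_bounded_linear[OF pi_BG[OF m]]
  show ?thesis unfolding amplify_def
    by (intro bounded_linear_Pair bounded_linear_compose[OF bm ff] bounded_linear_compose[OF bm sf]
        bounded_linear_compose[OF bp fs] bounded_linear_compose[OF bp ss])
qed

lemma inner_amplify: "m \<in> M \<Longrightarrow> inner (amplify m z) w = inner z (amplify (adj m) w)"
  by (simp add: amplify_def inner_prod_def inner_adj[OF M_BG] inner_adj[OF pi_BG] pi_adj)

lemma subspace_orbit: "subspace {amplify m z |m. m \<in> M}"
proof (rule subspaceI)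
  have "amplify (opscale (complex_of_real 0) id) z = 0"
    unfolding amplify_def pi_opscale_real_apply[OF M_id] opscale_real_apply by (simp add: zero_prod_def)
  then show "0 \<in> {amplify m z |m. m \<in> M}" using M_scale[OF M_id] by force
next
  fix a b assume "a \<in> {amplify m z |m. m \<in> M}" "b \<in> {amplify m z |m. m \<in> M}"
  then obtain m n where m: "m \<in> M" "a = amplify m z" and n: "n \<in> M" "b = amplify n z" by blast
  have "a + b = amplify (opadd m n) z"
    unfolding m(2) n(2) amplify_def pi_opadd_apply[OF m(1) n(1)] opadd_apply by simp
  then show "a + b \<in> {amplify m z |m. m \<in> M}" using M_add m n by blast
next
  fix c :: real and a assume "a \<in> {amplify m z |m. m \<in> M}"
  then obtain m where m: "m \<in> M" "a = amplify m z" by blast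
  have "c *\<^sub>R a = amplify (opscale (complex_of_real c) m) z"
    unfolding m(2) amplify_def pi_opscale_real_apply[OF m(1)] opscale_real_apply by simp
  then show "c *\<^sub>R a \<in> {amplify m z |m. m \<in> M}" using M_scale m by blast
qed

text \<open>Without intertwiners from \<open>id\<close> to \<open>\<pi>\<close> reaching \<open>\<xi>\<close>, the projection onto a cyclic subspace
  of \<open>id \<oplus> id \<oplus> \<pi> \<oplus> \<pi>\<close> is block diagonal; the second copy makes it possible to symmetrise
  the approximating elements of \<open>M\<close>.\<close>

lemma cyclic_splits:
  assumes no: "\<forall>y\<in>BG. (\<forall>m\<in>M. \<pi> m \<circ> y = y \<circ> m) \<longrightarrow> (\<forall>v. inner (y v) \<xi> = 0)"
    and h: "h \<in> closure {\<pi> m \<xi> |m. m \<in> M}"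
  shows "((\<eta>, g), (0, 0)) \<in> closure {amplify m ((\<eta>, g), (\<xi>, h)) |m. m \<in> M}"
proof -
  define H where "H = closure {\<pi> m \<xi> |m. m \<in> M}"
  define z where "z = ((\<eta>, g), (\<xi>, h))"
  define K where "K = closure {amplify m z |m. m \<in> M}"
  have K: "subspace K" "closed K" unfolding K_def using subspace_closure[OF subspace_orbit] by auto
  define P where "P = orth_proj K"
  have Kinv: "amplify m k \<in> K" if "m \<in> M" "k \<in> K" for m k
    unfolding K_def
  proof (rule closure_invariant[OF bounded_linear_amplify[OF \<open>m \<in> M\<close>]])
    show "k \<in> closure {amplify m z |m. m \<in> M}" using that by (simp add: K_def)
    fix k' assume "k' \<in> {amplify m z |m. m \<in> M}"
    then obtain n where n: "n \<in> M" "k' = amplify n z" by blast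
    then have "amplify m k' = amplify (m \<circ> n) z" using \<open>m \<in> M\<close> by (simp add: amplify_def pi_comp)
    then have "amplify m k' \<in> {amplify m z |m. m \<in> M}" using M_comp n \<open>m \<in> M\<close> by blast
    then show "amplify m k' \<in> closure {amplify m z |m. m \<in> M}" by (rule subsetD[OF closure_subset])
  qed
  \<comment> \<open>\<open>K\<close> is invariant under every \<open>amplify m\<close>, and
    \<open>M\<close> is closed under adjoints, so \<open>P\<close> commutes with the amplified
    action.\<close>
  have Pcomm: "P (amplify m x) = amplify m (P x)" if "m \<in> M" for m x
    unfolding P_def
  proof (rule orth_proj_commute[OF K])
    show "linear (amplify m)" using bounded_linear_amplify[OF that] by (rule bounded_linear.linear)
    show "inner (amplify m x) y = inner x (amplify (adj m) y)" for x y by (rule inner_amplify[OF that])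
  qed (use Kinv that M_adj in auto)
  have Hinv: "\<pi> m k \<in> H" if "m \<in> M" "k \<in> H" for m k
    unfolding H_def
  proof (rule closure_invariant[OF BG_bounded_linear[OF pi_BG[OF \<open>m \<in> M\<close>]]])
    show "k \<in> closure {\<pi> m \<xi> |m. m \<in> M}" using that by (simp add: H_def)
    fix k' assume "k' \<in> {\<pi> m \<xi> |m. m \<in> M}"
    then obtain n where n: "n \<in> M" "k' = \<pi> n \<xi>" by blast
    then have "\<pi> m k' = \<pi> (m \<circ> n) \<xi>" using \<open>m \<in> M\<close> by (simp add: pi_comp)
    then have "\<pi> m k' \<in> {\<pi> m \<xi> |m. m \<in> M}" using M_comp n \<open>m \<in> M\<close> by blast
    then show "\<pi> m k' \<in> closure {\<pi> m \<xi> |m. m \<in> M}" by (rule subsetD[OF closure_subset])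
  qed
  have xiH: "\<xi> \<in> H"
  proof -
    have "\<pi> id \<xi> \<in> {\<pi> m \<xi> |m. m \<in> M}" using M_id by blast
    then show ?thesis unfolding H_def pi_id id_apply by (rule subsetD[OF closure_subset])
  qed
  \<comment> \<open>Both \<open>\<pi>\<close> coordinates of \<open>K\<close> stay in the cyclic
    subspace \<open>H\<close>, since \<open>\<xi>\<close> and \<open>h\<close> lie there.\<close>
  have KH: "fst (snd k) \<in> H \<and> snd (snd k) \<in> H" if "k \<in> K" for k
  proof
    have hH: "h \<in> H" using h by (simp add: H_def)
    have *: "closed H" by (simp add: H_def)
    have "fst (snd k) \<in> closure H"
    proof (rule closure_invariant[of "\<lambda>k. fst (snd k)" "{amplify m z |m. m \<in> M}" H k])
      show "bounded_linear (\<lambda>k::('a \<times> 'a) \<times> 'a \<times> 'a. fst (snd k))"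
        by (intro bounded_linear_compose[OF bounded_linear_fst] bounded_linear_snd)
      show "fst (snd x) \<in> closure H" if "x \<in> {amplify m z |m. m \<in> M}" for x
        using that Hinv xiH * by (auto simp: amplify_def z_def)
    qed (use that in \<open>simp add: K_def\<close>)
    then show "fst (snd k) \<in> H" using * by simp
    have "snd (snd k) \<in> closure H"
    proof (rule closure_invariant[of "\<lambda>k. snd (snd k)" "{amplify m z |m. m \<in> M}" H k])
      show "bounded_linear (\<lambda>k::('a \<times> 'a) \<times> 'a \<times> 'a. snd (snd k))"
        by (intro bounded_linear_compose[OF bounded_linear_snd] bounded_linear_snd)
      show "snd (snd x) \<in> closure H" if "x \<in> {amplify m z |m. m \<in> M}" for x
        using that Hinv hH * by (auto simp: amplify_def z_def)
    qed (use that in \<open>simp add: K_def\<close>)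
    then show "snd (snd k) \<in> H" using * by simp
  qed
  \<comment> \<open>A matrix entry of \<open>P\<close> from an identity coordinate to a
    \<open>\<pi>\<close> coordinate is an intertwiner. By \<open>no\<close> its range is orthogonal
    to \<open>\<xi>\<close>, hence to \<open>H\<close>, but it also lies in
    \<open>H\<close>.\<close>
  have block: "pr (P (\<iota> v)) = 0"
    if pr: "bounded_linear pr" "\<And>m x. m \<in> M \<Longrightarrow> pr (amplify m x) = \<pi> m (pr x)" "\<And>k. k \<in> K \<Longrightarrow> pr k \<in> H"
      and \<iota>: "bounded_linear \<iota>" "\<And>m v. m \<in> M \<Longrightarrow> \<iota> (m v) = amplify m (\<iota> v)"
    for pr and \<iota> :: "'a \<Rightarrow> ('a \<times> 'a) \<times> 'a \<times> 'a" and v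
  proof -
    define y where "y v = pr (P (\<iota> v))" for v
    have int: "y (m v) = \<pi> m (y v)" if "m \<in> M" for m v
      using that by (simp add: y_def \<iota> Pcomm pr)
    have "bounded_linear y" unfolding y_def P_def
      by (rule bounded_linear_compose[OF pr(1) bounded_linear_compose[OF bounded_linear_orth_proj[OF K] \<iota>(1)]])
    \<comment> \<open>Complex linearity is intertwining with the multiple of \<open>id\<close> by
      the imaginary unit.\<close>
    moreover have "y (cJ v) = cJ (y v)" for v
      using int[OF M_scale[OF M_id, of \<i>], of v] unfolding pi_scale[OF M_id] pi_id opscale_i_id .
    ultimately have "y \<in> BG" by (simp add: BG_iff)
    moreover have int': "\<pi> m \<circ> y = y \<circ> m" if "m \<in> M" for m using int[OF that] by (simp add: fun_eq_iff)
    ultimately have "inner (y v) \<xi> = 0" for v using no by blast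
    moreover have "y v \<in> H" unfolding y_def P_def by (intro pr orth_proj_in[OF K])
    ultimately have "inner (y v) (y v) = 0" using intertwiner_orthogonal[OF int'] unfolding H_def by blast
    then show ?thesis by (simp add: y_def)
  qed
  have i1: "bounded_linear (\<lambda>v::'a. ((v, 0::'a), (0::'a, 0::'a)))"
    and i2: "bounded_linear (\<lambda>v::'a. ((0::'a, v), (0::'a, 0::'a)))"
    by (intro bounded_linear_Pair bounded_linear_ident bounded_linear_zero)+
  have p1: "bounded_linear (\<lambda>k::('a \<times> 'a) \<times> 'a \<times> 'a. fst (snd k))"
    and p2: "bounded_linear (\<lambda>k::('a \<times> 'a) \<times> 'a \<times> 'a. snd (snd k))"
    by (intro bounded_linear_compose[OF bounded_linear_snd] bounded_linear_compose[OF bounded_linear_fst]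
        bounded_linear_snd)+
  have ja: "m \<in> M \<Longrightarrow> ((m v, 0), (0, 0)) = amplify m ((v, 0), (0, 0))"
    "m \<in> M \<Longrightarrow> ((0, m v), (0, 0)) = amplify m ((0, v), (0, 0))" for m v
    by (simp_all add: amplify_def BG_zero[OF M_BG] BG_zero[OF pi_BG])
  have pa: "fst (snd (amplify m x)) = \<pi> m (fst (snd x))" "snd (snd (amplify m x)) = \<pi> m (snd (snd x))" for m x
    by (simp_all add: amplify_def)
  have e1: "snd (P ((v, 0), (0, 0))) = 0" and e2: "snd (P ((0, v), (0, 0))) = 0" for v
    using block[OF p1 pa(1) _ i1 ja(1)] block[OF p2 pa(2) _ i1 ja(1)]
      block[OF p1 pa(1) _ i2 ja(2)] block[OF p2 pa(2) _ i2 ja(2)] KH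
    by (simp_all add: prod_eq_iff)
  interpret P: bounded_linear P unfolding P_def by (rule bounded_linear_orth_proj[OF K])
  have off: "snd (P (a, 0)) = 0" for a
  proof -
    have "(a, 0) = ((fst a, 0), (0, 0)) + ((0, snd a), (0::'a, 0::'a))" by (simp add: prod_eq_iff)
    then show ?thesis by (metis P.add e1 e2 snd_add add_0)
  qed
  define a b where "a = (\<eta>, g)" and "b = (\<xi>, h)"
  have zab: "z = (a, 0) + (0, b)" by (simp add: z_def a_def b_def)
  have zK: "z \<in> K"
  proof -
    have "amplify id z \<in> {amplify m z |m. m \<in> M}" using M_id by blast
    then have "amplify id z \<in> K" unfolding K_def by (rule subsetD[OF closure_subset])
    then show ?thesis by (simp add: pi_id amplify_def)
  qed
  define a' where "a' = fst (P (a, 0))"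
  have Pa: "P (a, 0) = (a', 0)" using off[of a] by (simp add: a'_def prod_eq_iff)
  \<comment> \<open>Since \<open>P\<close> fixes \<open>z\<close> and maps \<open>(a, 0)\<close> to
    \<open>(a', 0)\<close>, it maps \<open>(0, b)\<close> to \<open>(a - a', b)\<close>. Symmetry of
    \<open>P\<close> then forces \<open>a = a'\<close>.\<close>
  have "P z = z" unfolding P_def by (rule orth_proj_fixed[OF K zK])
  then have Pb: "P (0, b) = (a - a', b)" using Pa P.add[of "(a, 0)" "(0, b)"]
    by (simp add: zab) (metis add_diff_cancel_left' diff_Pair diff_zero)
  have "inner (a - a') (a - a') = inner (P (0, b)) (a - a', 0)" by (simp add: Pb inner_prod_def)
  also have "\<dots> = inner (0, b) (P (a - a', 0))" unfolding P_def by (rule inner_orth_proj[OF K])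
  also have "\<dots> = 0" using off[of "a - a'"] by (simp add: inner_prod_def)
  finally have "P (a, 0) = (a, 0)" using Pa by simp
  then have "(a, 0) \<in> K" unfolding P_def using orth_proj_in[OF K] by metis
  then show ?thesis by (simp add: K_def a_def z_def zero_prod_def)
qed

text \<open>Let \<open>(g, h)\<close> be the component of \<open>(\<eta>, 0)\<close> orthogonal to
  the closed real subspace. Testing it against \<open>x = m + adj m\<close> and moving the adjoints
  across shows that \<open>((g, \<eta>), (h, \<xi>))\<close> is orthogonal to the amplified orbit of
  \<open>((\<eta>, g), (\<xi>, h))\<close>. Since that orbit splits,
  \<open>inner g \<eta> = 0\<close>, and the component vanishes.\<close>

lemma selfadjoint_approximation:
  assumes no: "\<forall>y\<in>BG. (\<forall>m\<in>M. \<pi> m \<circ> y = y \<circ> m) \<longrightarrow> (\<forall>v. inner (y v) \<xi> = 0)"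
  shows "(\<eta>, 0) \<in> closure {(x \<eta>, \<pi> x \<xi>) |x. x \<in> M \<and> self_adjoint x}"
proof -
  define L0 where "L0 = {(x \<eta>, \<pi> x \<xi>) |x. x \<in> M \<and> self_adjoint x}"
  have "subspace L0"
  proof (rule subspaceI)
    have "(0, 0) = (opscale (complex_of_real 0) id \<eta>, \<pi> (opscale (complex_of_real 0) id) \<xi>)"
      unfolding pi_opscale_real_apply[OF M_id] opscale_real_apply by simp
    then show "0 \<in> L0" unfolding L0_def zero_prod_def
      using M_scale[OF M_id] opscale_real_sa[OF self_adjoint_id] by blast
  next
    fix a b assume "a \<in> L0" "b \<in> L0"
    then obtain x y where x: "x \<in> M" "self_adjoint x" "a = (x \<eta>, \<pi> x \<xi>)"
      and y: "y \<in> M" "self_adjoint y" "b = (y \<eta>, \<pi> y \<xi>)" unfolding L0_def by blast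
    have "a + b = (opadd x y \<eta>, \<pi> (opadd x y) \<xi>)"
      unfolding x(3) y(3) pi_opadd_apply[OF x(1) y(1)] opadd_apply by simp
    then show "a + b \<in> L0" unfolding L0_def using x y M_add opadd_sa by blast
  next
    fix c :: real and a assume "a \<in> L0"
    then obtain x where x: "x \<in> M" "self_adjoint x" "a = (x \<eta>, \<pi> x \<xi>)" unfolding L0_def by blast
    have "c *\<^sub>R a = (opscale (complex_of_real c) x \<eta>, \<pi> (opscale (complex_of_real c) x) \<xi>)"
      unfolding x(3) pi_opscale_real_apply[OF x(1)] opscale_real_apply by simp
    then show "c *\<^sub>R a \<in> L0" unfolding L0_def using x M_scale opscale_real_sa by blast
  qed
  then have L: "subspace (closure L0)" "closed (closure L0)" using subspace_closure by auto
  define p where "p = orth_proj (closure L0) (\<eta>, 0)"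
  have pL: "p \<in> closure L0" unfolding p_def by (rule orth_proj_in[OF L])
  define g h where "g = \<eta> - fst p" and "h = - snd p"
  have gh: "(\<eta>, 0) - p = (g, h)" by (simp add: g_def h_def prod_eq_iff)
  have orth: "inner (g, h) k = 0" if "k \<in> closure L0" for k
    unfolding gh[symmetric] p_def by (rule orth_proj_inner[OF L that])
  have h: "h \<in> closure {\<pi> m \<xi> |m. m \<in> M}"
  proof (unfold h_def, rule closure_invariant[OF _ _ pL])
    show "bounded_linear (\<lambda>k::'a \<times> 'a. - snd k)" by (intro bounded_linear_minus bounded_linear_snd)
    fix k assume "k \<in> L0"
    then obtain x where x: "x \<in> M" "k = (x \<eta>, \<pi> x \<xi>)" unfolding L0_def by blast
    have "- snd k = \<pi> (opscale (complex_of_real (-1)) x) \<xi>"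
      unfolding pi_opscale_real_apply[OF x(1)] by (simp add: x(2))
    then have "- snd k \<in> {\<pi> m \<xi> |m. m \<in> M}" using M_scale x by blast
    then show "- snd k \<in> closure {\<pi> m \<xi> |m. m \<in> M}" by (rule subsetD[OF closure_subset])
  qed
  have "inner ((g, \<eta>), (h, \<xi>)) ((\<eta>, g), (0, 0)) = 0"
  proof (rule inner_zero_closure[OF _ cyclic_splits[OF no h]])
    fix k assume "k \<in> {amplify m ((\<eta>, g), (\<xi>, h)) |m. m \<in> M}"
    then obtain m where m: "m \<in> M" "k = amplify m ((\<eta>, g), (\<xi>, h))" by blast
    define x where "x = opadd m (adj m)"
    have "x \<in> M" unfolding x_def using m M_add M_adj by blast
    moreover have "self_adjoint x" unfolding self_adjoint_iff
      using m M_BG M_adj by (auto simp: x_def opadd_BG)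
        (simp add: opadd_apply inner_add_left inner_add_right inner_adj[OF M_BG]
          adj_adj[OF M_BG])
    ultimately have "(x \<eta>, \<pi> x \<xi>) \<in> L0" unfolding L0_def by blast
    then have "(x \<eta>, \<pi> x \<xi>) \<in> closure L0" by (rule subsetD[OF closure_subset])
    then have "inner (g, h) (x \<eta>, \<pi> x \<xi>) = 0" by (rule orth)
    then have "inner g (m \<eta>) + inner g (adj m \<eta>) + inner h (\<pi> m \<xi>) + inner h (adj (\<pi> m) \<xi>) = 0"
      unfolding x_def pi_opadd_apply[OF m(1) M_adj[OF m(1)]] opadd_apply pi_adj[OF m(1)]
      by (simp add: inner_prod_def inner_add_right)
    then show "inner ((g, \<eta>), (h, \<xi>)) k = 0"
      using m(1) inner_adj[OF M_BG, of m g \<eta>] inner_adj[OF pi_BG, of m h \<xi>]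
      by (simp add: m(2) amplify_def inner_prod_def inner_commute[of \<eta>] inner_commute[of \<xi>])
  qed
  then have "inner g \<eta> = 0" by (simp add: inner_prod_def inner_commute)
  have "inner (g, h) (g, h) = inner (g, h) (\<eta>, 0) - inner (g, h) p"
    unfolding gh[symmetric] by (simp add: inner_diff_right)
  also have "\<dots> = 0" using orth[OF pL] \<open>inner g \<eta> = 0\<close> by (simp add: inner_prod_def)
  finally have "(g, h) = 0" unfolding inner_eq_zero_iff .
  then show ?thesis using gh pL unfolding L0_def by simp
qed

text \<open>At \<open>\<eta>\<close> a fixed tolerance suffices, namely the one in
  \<open>resolvent_square_bound\<close>; at \<open>\<xi>\<close> the squared norms must be summable
  so that tails of the series vanish.\<close>

lemma approximating_sequence:
  assumes no: "\<forall>y\<in>BG. (\<forall>m\<in>M. \<pi> m \<circ> y = y \<circ> m) \<longrightarrow> (\<forall>v. inner (y v) \<xi> = 0)"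
    and eta: "\<eta> \<noteq> 0"
  obtains x where "\<And>n. x n \<in> M" "\<And>n. self_adjoint (x n)" "\<And>n. norm (x n \<eta> - \<eta>) \<le> norm \<eta> / 8"
    "\<And>n. (norm (\<pi> (x n) \<xi>))\<^sup>2 \<le> (1/2) ^ n"
proof -
  have "\<exists>x. x \<in> M \<and> self_adjoint x \<and> norm (x \<eta> - \<eta>) \<le> norm \<eta> / 8 \<and> (norm (\<pi> x \<xi>))\<^sup>2 \<le> (1/2) ^ n"
    for n
  proof -
    define e where "e = min (norm \<eta> / 8) (sqrt ((1/2) ^ n))"
    have "e > 0" using eta by (simp add: e_def)
    then obtain k where "k \<in> {(x \<eta>, \<pi> x \<xi>) |x. x \<in> M \<and> self_adjoint x}" "dist k (\<eta>, 0) < e"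
      using selfadjoint_approximation[OF no, of \<eta>] unfolding closure_approachable by blast
    then obtain x where x: "x \<in> M" "self_adjoint x" and d: "dist (x \<eta>, \<pi> x \<xi>) (\<eta>, 0) < e" by blast
    have "norm (x \<eta> - \<eta>) < e" using dist_fst_le[of "(x \<eta>, \<pi> x \<xi>)" "(\<eta>, 0)"] d by (simp add: dist_norm)
    moreover have "norm (\<pi> x \<xi>) < e" using dist_snd_le[of "(x \<eta>, \<pi> x \<xi>)" "(\<eta>, 0)"] d by (simp add: dist_norm)
    then have "(norm (\<pi> x \<xi>))\<^sup>2 \<le> (sqrt ((1/2) ^ n))\<^sup>2" by (intro power_mono) (auto simp: e_def)
    ultimately show ?thesis using x by (intro exI[of _ x]) (auto simp: e_def)
  qed
  then obtain x where "\<forall>n. x n \<in> M \<and> self_adjoint (x n) \<and> norm (x n \<eta> - \<eta>) \<le> norm \<eta> / 8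
      \<and> (norm (\<pi> (x n) \<xi>))\<^sup>2 \<le> (1/2) ^ n"
    by metis
  then show ?thesis using that by blast
qed

text \<open>A \<open>limsup\<close> construction: \<open>c = inf\<^sub>N sup\<^sub>m S / (1 + S)\<close> with \<open>S = \<Sum>n=N..m. x\<^sub>n\<^sup>2\<close>.\<close>

lemma annihilating_element:
  assumes no: "\<forall>y\<in>BG. (\<forall>m\<in>M. \<pi> m \<circ> y = y \<circ> m) \<longrightarrow> (\<forall>v. inner (y v) \<xi> = 0)"
    and eta: "\<eta> \<noteq> 0" and xi: "\<xi> \<noteq> 0"
  shows "\<exists>c\<in>M. \<pi> c \<xi> = 0 \<and> c \<eta> \<noteq> 0"
proof -
  obtain x where xM: "\<And>n. x n \<in> M" and xsa: "\<And>n. self_adjoint (x n)"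
    and xeta: "\<And>n. norm (x n \<eta> - \<eta>) \<le> norm \<eta> / 8" and xxi: "\<And>n. (norm (\<pi> (x n) \<xi>))\<^sup>2 \<le> (1/2) ^ n"
    using approximating_sequence[OF no eta] by metis
  have setM: "set (map x l) \<subseteq> M" and setB: "set (map x l) \<subseteq> BG" for l using xM M_BG by auto
  \<comment> \<open>\<open>c N m\<close> increases with \<open>m\<close> and decreases with
    \<open>N\<close>; the two monotone limits are taken in this order.\<close>
  define c where "c N m = defect (gram (map x [N..<m]))" for N m
  have cM: "c N m \<in> M" for N m unfolding c_def by (rule defect_gram_M[OF setM])
  note po = gram_positive_op[OF setM]
  have csa: "self_adjoint (c N m)" and c0: "0 \<le> inner v (c N m v)" and c1: "inner v (c N m v) \<le> inner v v"
    and cg: "inner v (c N m v) \<le> inner v (gram (map x [N..<m]) v)" for N m v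
    unfolding c_def by (rule positive_op.defect_sa[OF po] positive_op.defect_ge[OF po]
        positive_op.defect_le_id[OF po] positive_op.defect_le[OF po])+
  have append: "inner v (defect (gram (map x l)) v) \<le> inner v (defect (gram (map x (l @ l'))) v)"
    "inner v (defect (gram (map x l')) v) \<le> inner v (defect (gram (map x (l @ l'))) v)" for l l' v
    using resolvent_gram_append[OF setB[of l] setB[of l'], of v] by (simp_all add: defect_apply inner_diff_right)
  have cmono: "inner v (c N m v) \<le> inner v (c N (Suc m) v)" for N m v
    unfolding c_def using append(1)[of v "[N..<m]" "[m]"] by (cases "N \<le> m") auto
  have canti: "inner v (c (Suc N) m v) \<le> inner v (c N m v)" for N m v
    unfolding c_def using append(2)[of v "[Suc N..<m]" "[N]"] by (cases "N < m") (auto simp: upt_conv_Cons)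
  \<comment> \<open>\<open>Suc m\<close> puts the last summand \<open>x m\<close> into the half-open
    range; that summand alone gives 3/8 = 1 - 5/8.\<close>
  have ceta: "3/8 * inner \<eta> \<eta> \<le> inner \<eta> (c N (Suc m) \<eta>)" if "N \<le> m" for N m
    using append(2)[of \<eta> "[m]" "[N..<m]"] resolvent_square_bound[OF xsa xeta, of m] that
    unfolding c_def by (simp add: defect_apply inner_diff_right)
  have cxi: "inner \<xi> (\<pi> (c N m) \<xi>) \<le> 2 * (1/2) ^ N" for N m
  proof -
    have "inner \<xi> (\<pi> (c N m) \<xi>) \<le> inner \<xi> (\<pi> (gram (map x [N..<m])) \<xi>)"
      using pi_mono[OF cM gram_M[OF setM] csa, of "[N..<m]" N m] cg po[of "[N..<m]"]
      by (simp add: op_le_def positive_op_def)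
    also have "\<dots> = (\<Sum>n\<leftarrow>[N..<m]. (norm (\<pi> (x n) \<xi>))\<^sup>2)"
      unfolding inner_pi_gram[OF setM] by (simp add: comp_def)
    also have "\<dots> \<le> (\<Sum>n\<leftarrow>[N..<m]. (1/2) ^ n)" by (intro sum_list_mono xxi)
    also have "\<dots> \<le> 2 * (1/2) ^ N" by (rule halves_sum_list)
    finally show ?thesis .
  qed
  have "\<exists>S. self_adjoint S \<and> (\<forall>v. (\<lambda>m. c N m v) \<longlonglongrightarrow> S v)" for N
    using monotone_strong_limit[of "c N", OF csa c0 c1 cmono] by metis
  then obtain C where Csa: "\<And>N. self_adjoint (C N)" and Clim: "\<And>N v. (\<lambda>m. c N m v) \<longlonglongrightarrow> C N v"
    by metis
  have Clim': "(\<lambda>m. inner v (c N m v)) \<longlonglongrightarrow> inner v (C N v)" for N v by (intro tendsto_intros Clim)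
  have CM: "C N \<in> M" for N by (rule M_strong_limit[OF self_adjoint_BG[OF Csa] cM Clim])
  have C0: "0 \<le> inner v (C N v)" for N v by (rule LIMSEQ_le_const[OF Clim']) (auto simp: c0)
  have C1: "inner v (C N v) \<le> inner v v" for N v by (rule LIMSEQ_le_const2[OF Clim']) (auto simp: c1)
  have Canti: "inner v (C (Suc N) v) \<le> inner v (C N v)" for N v
    by (rule LIMSEQ_le[OF Clim' Clim']) (auto simp: canti)
  have Ceta: "3/8 * inner \<eta> \<eta> \<le> inner \<eta> (C N \<eta>)" for N
  proof (rule LIMSEQ_le_const[OF Clim'])
    show "\<exists>k. \<forall>n\<ge>k. 3/8 * inner \<eta> \<eta> \<le> inner \<eta> (c N n \<eta>)"
    proof (intro exI allI impI)
      fix n assume "Suc N \<le> n"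
      then show "3/8 * inner \<eta> \<eta> \<le> inner \<eta> (c N n \<eta>)" using ceta[of N "n - 1"] by simp
    qed
  qed
  have inc: "inner v (c N m v) \<le> inner v (c N n v)" if "m \<le> n" for v N m n
    using lift_Suc_mono_le[of "\<lambda>m. inner v (c N m v)"] cmono that by blast
  \<comment> \<open>The increasing limit is the supremum, so \<open>normal_bound\<close> carries the
    uniform bound over to it at the price of another factor 2.\<close>
  have Cxi: "inner \<xi> (\<pi> (C N) \<xi>) \<le> 2 * (2 * (1/2) ^ N)" for N
  proof (rule normal_bound[of "range (c N)"])
    show "\<exists>d\<in>range (c N). op_le a d \<and> op_le b d" if ab: "a \<in> range (c N)" "b \<in> range (c N)" for a b
    proof -
      obtain i j where "a = c N i" "b = c N j" using ab by blast
      then have "op_le a (c N (max i j))" "op_le b (c N (max i j))" using inc by (auto simp: op_le_def)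
      then show ?thesis by blast
    qed
    show "is_sa_lub (range (c N)) (C N)" unfolding is_sa_lub_def op_le_def
    proof (intro conjI ballI allI impI)
      show "self_adjoint (C N)" by (rule Csa)
      fix d v assume "d \<in> range (c N)"
      then obtain m where m: "d = c N m" by blast
      show "inner v (d v) \<le> inner v (C N v)" unfolding m
        by (rule LIMSEQ_le_const[OF Clim']) (use inc in blast)
    next
      fix t v assume t: "self_adjoint t \<and> (\<forall>d\<in>range (c N). \<forall>v. inner v (d v) \<le> inner v (t v))"
      show "inner v (C N v) \<le> inner v (t v)"
        by (rule LIMSEQ_le_const2[OF Clim']) (use t in blast)
    qed
  qed (use cM csa c0 c1 cxi xi in auto)
  \<comment> \<open>Complements turn the decreasing sequence \<open>C N\<close> into an increasing
    one, to which \<open>monotone_strong_limit\<close> applies.\<close>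
  obtain R where Rsa: "self_adjoint R" and Rlim: "\<And>v. (\<lambda>N. op_compl (C N) v) \<longlonglongrightarrow> R v"
  proof (rule monotone_strong_limit[of "\<lambda>N. op_compl (C N)"])
    show "self_adjoint (op_compl (C N))" for N by (rule op_compl_sa[OF Csa])
    show "0 \<le> inner v (op_compl (C N) v)" "inner v (op_compl (C N) v) \<le> inner v v"
      "inner v (op_compl (C N) v) \<le> inner v (op_compl (C (Suc N)) v)" for N v
      using C0[of v N] C1[of v N] Canti[of v N] by (simp_all add: op_compl_apply inner_diff_right)
  qed (use that in blast)
  have RM: "R \<in> M" by (rule M_strong_limit[OF self_adjoint_BG[OF Rsa] op_compl_M[OF CM] Rlim])
  define s where "s = op_compl R"
  have sM: "s \<in> M" and ssa: "self_adjoint s" unfolding s_def using op_compl_M[OF RM] op_compl_sa[OF Rsa] by auto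
  have "(\<lambda>N. C N v) \<longlonglongrightarrow> s v" for v
  proof -
    have "(\<lambda>N. v - op_compl (C N) v) \<longlonglongrightarrow> v - R v" by (intro tendsto_intros Rlim)
    then show ?thesis by (simp add: s_def op_compl_apply)
  qed
  then have slim: "(\<lambda>N. inner v (C N v)) \<longlonglongrightarrow> inner v (s v)" for v by (intro tendsto_intros)
  have s0: "0 \<le> inner v (s v)" for v by (rule LIMSEQ_le_const[OF slim]) (auto simp: C0)
  have s1: "inner v (s v) \<le> inner v v" for v by (rule LIMSEQ_le_const2[OF slim]) (auto simp: C1)
  have sC: "op_le s (C N)" for N unfolding op_le_def
  proof
    fix v
    have "inner v (C n v) \<le> inner v (C N v)" if "N \<le> n" for n
      using lift_Suc_antimono_le[of "\<lambda>m. inner v (C m v)"] Canti that by blast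
    then show "inner v (s v) \<le> inner v (C N v)" by (intro LIMSEQ_le_const2[OF slim]) blast
  qed
  have "inner \<xi> (\<pi> s \<xi>) \<le> 0"
  proof (rule LIMSEQ_le_const)
    show "(\<lambda>N. 2 * (2 * (1/2::real) ^ N)) \<longlonglongrightarrow> 0"
      by (intro tendsto_mult_right_zero LIMSEQ_realpow_zero) auto
    have "inner \<xi> (\<pi> s \<xi>) \<le> 2 * (2 * (1/2) ^ N)" for N
      using pi_mono[OF sM CM ssa Csa sC, of N] Cxi[of N] by (auto simp: op_le_def intro: order_trans)
    then show "\<exists>K. \<forall>N\<ge>K. inner \<xi> (\<pi> s \<xi>) \<le> 2 * (2 * (1/2) ^ N)" by blast
  qed
  \<comment> \<open>A positive contraction whose form vanishes at \<open>\<xi>\<close> annihilates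
    \<open>\<xi>\<close>.\<close>
  moreover have "(norm (\<pi> s \<xi>))\<^sup>2 \<le> inner \<xi> (\<pi> s \<xi>)"
    by (rule norm_apply_le_inner[OF pi_sa[OF sM ssa] pi_pos[OF sM ssa s0] pi_le_id[OF sM ssa s1]])
  ultimately have "\<pi> s \<xi> = 0" by (metis norm_eq_zero order_trans power2_less_eq_zero_iff)
  moreover have "3/8 * inner \<eta> \<eta> \<le> inner \<eta> (s \<eta>)" by (rule LIMSEQ_le_const[OF slim]) (use Ceta in blast)
  then have "s \<eta> \<noteq> 0" using eta by (auto simp: power2_norm_eq_inner[symmetric])
  ultimately show ?thesis using sM by blast
qed

text \<open>If no intertwiner detected \<open>\<xi>\<close>, then
  \<open>annihilating_element\<close> would supply the hypothesis of
  \<open>annihilator_kernel\<close>, forcing \<open>\<xi> = 0\<close>.\<close>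

theorem intertwiners_total:
  assumes "\<xi> \<noteq> 0"
  obtains y v where "y \<in> BG" "\<And>m. m \<in> M \<Longrightarrow> \<pi> m \<circ> y = y \<circ> m" "inner (y v) \<xi> \<noteq> 0"
  using annihilator_kernel[of \<xi>] annihilating_element[of \<xi>] assms by metis

end

section \<open>Commutants and unitaries\<close>

lemma von_neumann_algebra_commutant:
  assumes "von_neumann_algebra B"
  shows "von_neumann_algebra (commutant B)"
  unfolding von_neumann_algebra_def
proof (intro conjI ballI allI)
  have B: "B \<subseteq> BG" "\<And>x. x \<in> B \<Longrightarrow> adj x \<in> B" "commutant (commutant B) = B"
    using assms by (auto simp: von_neumann_algebra_def)
  have lin: "s (x + y) = s x + s y" "s (scaleC c x) = scaleC c (s x)" if "s \<in> B" for s x y c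
    using that B(1) BG_add BG_scaleC by blast+
  show "commutant B \<subseteq> BG" by (auto simp: commutant_def)
  show "id \<in> commutant B" by (auto simp: commutant_def id_BG)
  show "commutant (commutant (commutant B)) = commutant B" using B by simp
  fix x assume x: "x \<in> commutant B"
  show "opscale c x \<in> commutant B" for c
    using x lin by (auto simp: commutant_def opscale_BG) (auto simp: opscale_def fun_eq_iff)
  show "adj x \<in> commutant B" unfolding commutant_def
  proof (intro CollectI conjI ballI)
    have xB: "x \<in> BG" using x by (simp add: commutant_def)
    then show "adj x \<in> BG" by (rule adj_BG)
    fix s assume s: "s \<in> B"
    then have sB: "s \<in> BG" using B by blast
    \<comment> \<open>\<open>B\<close> is closed under adjoints, so \<open>x\<close> commutes with
      \<open>adj s\<close>; taking adjoints of this relation gives the claim.\<close>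
    have "adj (adj s \<circ> x) = adj (x \<circ> adj s)" using x B(2)[OF s] by (simp add: commutant_def)
    then show "adj x \<circ> s = s \<circ> adj x" using xB sB by (simp add: adj_comp adj_BG adj_adj)
  qed
  fix y assume y: "y \<in> commutant B"
  show "opadd x y \<in> commutant B"
    using x y lin by (auto simp: commutant_def opadd_BG) (auto simp: opadd_def fun_eq_iff)
  show "x \<circ> y \<in> commutant B"
    using x y by (auto simp: commutant_def comp_BG) (metis comp_assoc)
qed

definition unitary :: "('a::complex_hilbert) op \<Rightarrow> bool" where
  "unitary w \<longleftrightarrow> w \<in> BG \<and> adj w \<circ> w = id \<and> w \<circ> adj w = id"

lemma unitary_BG: "unitary w \<Longrightarrow> w \<in> BG"
  and unitary_left: "unitary w \<Longrightarrow> adj w (w v) = v"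
  and unitary_right: "unitary w \<Longrightarrow> w (adj w v) = v"
  by (auto simp: unitary_def fun_eq_iff)

lemma unitary_id: "unitary id"
  by (simp add: unitary_def id_BG adj_id)

lemma unitary_adj: "unitary w \<Longrightarrow> unitary (adj w)"
  by (simp add: unitary_def adj_BG adj_adj)

lemma unitary_comp:
  assumes "unitary v" "unitary w"
  shows "unitary (v \<circ> w)"
  using assms by (auto simp: unitary_def comp_BG adj_comp fun_eq_iff)

lemma unitary_funpow: "unitary w \<Longrightarrow> unitary (w ^^ n)"
  by (induction n) (auto simp: unitary_id unitary_comp)

lemma adj_funpow: "w \<in> BG \<Longrightarrow> w ^^ n \<in> BG \<and> adj (w ^^ n) = adj w ^^ n"
proof (induction n)
  case 0 then show ?case by (simp add: id_BG adj_id flip: id_def)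
next
  case (Suc n)
  then have "w \<circ> w ^^ n \<in> BG" "adj (w \<circ> w ^^ n) = adj w ^^ n \<circ> adj w"
    by (simp_all add: comp_BG adj_comp)
  then show ?case unfolding funpow_Suc_right[of n "adj w"] funpow.simps(2)[of n w] by (rule conjI)
qed

lemma star_automorphism_conj:
  assumes w: "unitary w"
  shows "star_automorphism_BG (\<lambda>x. w \<circ> x \<circ> adj w)"
proof -
  note wB = unitary_BG[OF w]
  have "bij_betw (\<lambda>x. w \<circ> x \<circ> adj w) BG BG"
    by (rule bij_betw_byWitness[where f' = "\<lambda>x. adj w \<circ> x \<circ> w"])
      (auto simp: fun_eq_iff unitary_left[OF w] unitary_right[OF w] comp_BG adj_BG wB)
  moreover have "star_hom BG BG (\<lambda>x. w \<circ> x \<circ> adj w)"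
    unfolding star_hom_def
    by (auto simp: comp_BG adj_BG wB fun_eq_iff opadd_def opscale_def BG_add[OF wB] BG_scaleC[OF wB]
        unitary_left[OF w] unitary_right[OF w] adj_comp adj_adj)
  ultimately show ?thesis by (simp add: star_automorphism_BG_def)
qed

subsection \<open>Automorphisms are implemented by unitaries\<close>

text \<open>The coefficient is the complex inner product of \<open>e\<close> and \<open>x\<close>,
  linear in \<open>x\<close>, recovered from the real one by means of \<open>cJ\<close>.\<close>

definition rank_one :: "'a::complex_hilbert \<Rightarrow> 'a \<Rightarrow> 'a op" where
  "rank_one v e = (\<lambda>x. scaleC (Complex (inner e x) (inner (cJ e) x)) v)"

lemma rank_one_apply: "rank_one v e x = inner e x *\<^sub>R v + inner (cJ e) x *\<^sub>R cJ v"
  by (simp add: rank_one_def scaleC_def)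

lemma rank_one_BG: "rank_one v e \<in> BG"
  unfolding BG_iff
proof
  show "bounded_linear (rank_one v e)" unfolding rank_one_apply[abs_def]
    by (intro bounded_linear_add bounded_linear_compose[OF bounded_linear_scaleR_left]
        bounded_linear_inner_right)
  show "\<forall>x. rank_one v e (cJ x) = cJ (rank_one v e x)"
    by (simp add: rank_one_apply cJ_add cJ_diff cJ_scaleR cJ_cJ inner_cJ inner_cJ_left)
qed

lemma comp_rank_one: "T \<in> BG \<Longrightarrow> T \<circ> rank_one v e = rank_one (T v) e"
  by (auto simp: fun_eq_iff rank_one_def BG_scaleC)

lemma opadd_rank_one: "opadd (rank_one v e) (rank_one v' e) = rank_one (v + v') e"
  by (simp add: opadd_def rank_one_apply fun_eq_iff cJ_add scaleR_add_right)

lemma opscale_rank_one: "opscale c (rank_one v e) = rank_one (scaleC c v) e"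
  by (auto simp: opscale_def rank_one_def scaleC_def fun_eq_iff cJ_add cJ_scaleR cJ_cJ algebra_simps)

lemma adj_rank_one: "adj (rank_one v e) = rank_one e v"
  by (rule adj_unique[OF rank_one_BG])
    (simp add: rank_one_apply inner_add_left inner_add_right inner_commute mult.commute)

text \<open>Composing a rank one operator with its adjoint's analogue leaves a scalar multiple of
  \<open>p\<close>, and \<open>\<alpha> p\<close> fixes \<open>f\<close>; this makes
  \<open>w\<close> isometric. From \<open>comp_rank_one\<close> one gets that
  \<open>\<alpha> x\<close> after \<open>w\<close> is \<open>w\<close> after
  \<open>x\<close>.\<close>

lemma automorphism_implemented:
  fixes \<alpha> :: "('a::complex_hilbert) op \<Rightarrow> 'a op"
  assumes "star_automorphism_BG \<alpha>"
  obtains w where "unitary w" "\<And>x. x \<in> BG \<Longrightarrow> \<alpha> x = w \<circ> x \<circ> adj w"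
proof (cases "\<exists>e::'a. e \<noteq> 0")
  case False
  \<comment> \<open>On the zero space all operators coincide.\<close>
  then have "f = g" for f g :: "'a op" by (intro ext) metis
  then show ?thesis using that[OF unitary_id] by blast
next
  case True
  then obtain e0 :: 'a where "e0 \<noteq> 0" by blast
  define e where "e = (1 / norm e0) *\<^sub>R e0"
  have "norm e = 1" using \<open>e0 \<noteq> 0\<close> by (simp add: e_def)
  then have e: "inner e e = 1" by (simp add: norm_eq_1)
  have \<alpha>BG: "x \<in> BG \<Longrightarrow> \<alpha> x \<in> BG" and \<alpha>comp: "x \<in> BG \<Longrightarrow> y \<in> BG \<Longrightarrow> \<alpha> (x \<circ> y) = \<alpha> x \<circ> \<alpha> y"
    and \<alpha>add: "x \<in> BG \<Longrightarrow> y \<in> BG \<Longrightarrow> \<alpha> (opadd x y) = opadd (\<alpha> x) (\<alpha> y)"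
    and \<alpha>scale: "x \<in> BG \<Longrightarrow> \<alpha> (opscale c x) = opscale c (\<alpha> x)"
    and \<alpha>adj: "x \<in> BG \<Longrightarrow> \<alpha> (adj x) = adj (\<alpha> x)" for x y c
    using assms by (auto simp: star_automorphism_BG_def star_hom_def)
  have bij: "inj_on \<alpha> BG" "\<alpha> ` BG = BG"
    using assms by (auto simp: star_automorphism_BG_def bij_betw_def)
  define p where "p = rank_one e e"
  have pB: "p \<in> BG" by (simp add: p_def rank_one_BG)
  have pe: "p e = e" using e by (simp add: p_def rank_one_apply inner_cJ_left inner_cJ_self)
  have pp: "p \<circ> p = p" using comp_rank_one[OF pB, of e e] by (simp add: pe p_def[symmetric])
  have "\<exists>g. \<alpha> p g \<noteq> 0"
  proof (rule ccontr)
    \<comment> \<open>Injectivity of \<open>\<alpha>\<close> is what keeps \<open>\<alpha> p\<close>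
      from being zero.\<close>
    assume "\<not> (\<exists>g. \<alpha> p g \<noteq> 0)"
    then have "\<alpha> p = \<alpha> (opscale 0 p)" by (simp add: \<alpha>scale[OF pB] fun_eq_iff opscale_zero_apply)
    then have "p = opscale 0 p" using inj_onD[OF bij(1)] pB opscale_BG by blast
    then have "p e = 0" by (metis opscale_zero_apply)
    then show False using pe e by simp
  qed
  then obtain g where g: "\<alpha> p g \<noteq> 0" by blast
  define f where "f = (1 / norm (\<alpha> p g)) *\<^sub>R \<alpha> p g"
  have "norm f = 1" using g by (simp add: f_def)
  then have f: "inner f f = 1" by (simp add: norm_eq_1)
  have "\<alpha> p (\<alpha> p g) = \<alpha> p g" using \<alpha>comp[OF pB pB] by (simp add: pp fun_eq_iff)
  then have pf: "\<alpha> p f = f" by (simp add: f_def BG_scaleR[OF \<alpha>BG[OF pB]])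
  define w where "w v = \<alpha> (rank_one v e) f" for v
  have w_scale: "w (scaleC c v) = scaleC c (w v)" for c v
    unfolding w_def opscale_rank_one[symmetric] \<alpha>scale[OF rank_one_BG] by (simp add: opscale_def)
  have w_add: "w (v + v') = w v + w v'" for v v'
    unfolding w_def opadd_rank_one[symmetric] \<alpha>add[OF rank_one_BG rank_one_BG] by (simp add: opadd_def)
  have w_inner: "inner (w v) (w v') = inner v v'" for v v'
  proof -
    define c where "c = Complex (inner v v') (inner (cJ v) v')"
    have "inner (w v) (w v') = inner f ((\<alpha> (rank_one e v) \<circ> \<alpha> (rank_one v' e)) f)"
      unfolding w_def by (simp add: inner_adj[OF \<alpha>BG[OF rank_one_BG]] \<alpha>adj[OF rank_one_BG, symmetric] adj_rank_one)
    also have "\<alpha> (rank_one e v) \<circ> \<alpha> (rank_one v' e) = \<alpha> (opscale c p)"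
      unfolding \<alpha>comp[OF rank_one_BG rank_one_BG, symmetric] comp_rank_one[OF rank_one_BG]
      by (simp add: p_def opscale_rank_one c_def) (simp add: rank_one_def)
    also have "\<alpha> (opscale c p) f = scaleC c f"
      unfolding \<alpha>scale[OF pB] by (simp add: opscale_def pf)
    also have "inner f (scaleC c f) = inner v v'"
      by (simp add: scaleC_def inner_add_right inner_cJ_self f c_def)
    finally show ?thesis .
  qed
  have wB: "w \<in> BG" unfolding BG_def
  proof (intro CollectI conjI allI w_scale bounded_linear_intro[of _ 1] w_add)
    show "w (r *\<^sub>R x) = r *\<^sub>R w x" for r x
      using w_scale[of "complex_of_real r" x] by (simp add: scaleC_def)
    show "norm (w x) \<le> norm x * 1" for x by (simp add: norm_eq_sqrt_inner w_inner)
  qed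
  have left: "adj w (w v) = v" for v
  proof -
    have "inner (adj w (w v) - v) x = 0" for x
      by (simp add: inner_diff_left inner_adj'[OF wB] w_inner)
    then have "adj w (w v) - v = 0" using inner_eq_zero_iff by blast
    then show ?thesis by simp
  qed
  have inter: "\<alpha> x (w v) = w (x v)" if "x \<in> BG" for x v
    using \<alpha>comp[OF that rank_one_BG, of v e] comp_rank_one[OF that, of v e]
    by (simp add: w_def fun_eq_iff)
  have we: "inner (w e) (w e) = 1" by (simp add: w_inner e)
  have surj: "\<exists>v. g = w v" for g
  proof -
    \<comment> \<open>Surjectivity of \<open>\<alpha>\<close> gives surjectivity of
      \<open>w\<close>: a preimage \<open>x\<close> of this operator satisfies
      \<open>w (x e) = g\<close>.\<close>
    have "rank_one g (w e) \<in> \<alpha> ` BG" using bij(2) rank_one_BG by blast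
    then obtain x where x: "x \<in> BG" "rank_one g (w e) = \<alpha> x" by blast
    have "g = rank_one g (w e) (w e)" using we by (simp add: rank_one_apply inner_cJ_left inner_cJ_self)
    also have "\<dots> = w (x e)" using x inter by simp
    finally show ?thesis by blast
  qed
  have right: "w (adj w g) = g" for g using surj[of g] left by metis
  have "unitary w" using wB left right by (simp add: unitary_def fun_eq_iff)
  moreover have "\<alpha> x = w \<circ> x \<circ> adj w" if "x \<in> BG" for x
  proof
    fix v
    show "\<alpha> x v = (w \<circ> x \<circ> adj w) v" using inter[OF that, of "adj w v"] by (simp add: right)
  qed
  ultimately show ?thesis by (rule that)
qed

subsection \<open>Both conditions mean that a unitary implements \<open>\<theta>\<close> and \<open>\<theta>'\<close>\<close>

text \<open>The adjoint stands on opposite sides because conjugation by \<open>w\<close> is to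
  extend \<open>\<theta>'\<close>, its inverse \<open>\<theta>\<close>.\<close>

definition implements :: "('a::complex_hilbert) op \<Rightarrow> 'a op set \<Rightarrow> ('a op \<Rightarrow> 'a op) \<Rightarrow> ('a op \<Rightarrow> 'a op) \<Rightarrow> bool"
  where "implements w B \<theta> \<theta>' \<longleftrightarrow> unitary w \<and> (\<forall>b\<in>B. \<theta> b = adj w \<circ> b \<circ> w)
    \<and> (\<forall>b\<in>commutant B. \<theta>' b = w \<circ> b \<circ> adj w)"

text \<open>Membership in \<open>A\<close> is carried through the induction because the conjugation
  formula is only available on \<open>A\<close>.\<close>

lemma funpow_conj:
  assumes "\<And>b. b \<in> A \<Longrightarrow> \<theta> b \<in> A" "\<And>b. b \<in> A \<Longrightarrow> \<theta> b = v \<circ> b \<circ> w" "b \<in> A"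
  shows "(\<theta> ^^ n) b \<in> A \<and> (\<theta> ^^ n) b = (v ^^ n) \<circ> b \<circ> (w ^^ n)"
proof (induction n)
  case (Suc n)
  then have IH: "(\<theta> ^^ n) b \<in> A" "(\<theta> ^^ n) b = (v ^^ n) \<circ> b \<circ> (w ^^ n)" by blast+
  have step: "(\<theta> ^^ Suc n) b = \<theta> ((\<theta> ^^ n) b)" by simp
  also have "\<dots> = v \<circ> (\<theta> ^^ n) b \<circ> w" by (rule assms(2)[OF IH(1)])
  also have "\<dots> = (v ^^ Suc n) \<circ> b \<circ> (w ^^ Suc n)"
    unfolding IH(2) funpow_Suc_right[of n w] funpow.simps(2)[of n v] comp_assoc by (rule refl)
  finally have "(\<theta> ^^ Suc n) b = (v ^^ Suc n) \<circ> b \<circ> (w ^^ Suc n)" .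
  moreover have "(\<theta> ^^ Suc n) b \<in> A" unfolding step by (rule assms(1)[OF IH(1)])
  ultimately show ?case by (intro conjI)
qed (use assms in simp)

context
  fixes B :: "('a::complex_hilbert) op set" and \<theta> \<theta>' :: "'a op \<Rightarrow> 'a op"
  assumes B: "von_neumann_algebra B" and \<theta>: "normal_unital_star_endo B \<theta>"
    and \<theta>': "normal_unital_star_endo (commutant B) \<theta>'"
begin

lemma endo_closed: "b \<in> B \<Longrightarrow> \<theta> b \<in> B" "b \<in> commutant B \<Longrightarrow> \<theta>' b \<in> commutant B"
  using \<theta> \<theta>' by (auto simp: normal_unital_star_endo_def star_hom_def)

lemma B_BG: "b \<in> B \<Longrightarrow> b \<in> BG" and B_id: "id \<in> B"
  and B_bicommutant: "commutant (commutant B) = B"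
  using B by (auto simp: von_neumann_algebra_def)

lemma implements_funpow:
  assumes "implements w B \<theta> \<theta>'"
  shows "b \<in> B \<Longrightarrow> (\<theta> ^^ n) b \<in> B" "b \<in> B \<Longrightarrow> (\<theta> ^^ n) b = (adj w ^^ n) \<circ> b \<circ> (w ^^ n)"
    "b \<in> commutant B \<Longrightarrow> (\<theta>' ^^ n) b = (w ^^ n) \<circ> b \<circ> (adj w ^^ n)"
  using assms funpow_conj[of B \<theta> "adj w" w b n] funpow_conj[of "commutant B" \<theta>' w "adj w" b n] endo_closed
  by (auto simp: implements_def)

text \<open>A unitary implementing \<open>\<alpha> 1\<close> gives the formula for
  \<open>\<theta>'\<close> at once; for \<open>\<theta>\<close> it follows from
  \<open>\<alpha> 1 (\<alpha> (-1) b) = b\<close>.\<close>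

lemma pairing_imp_implements:
  assumes "pairing B \<theta> \<theta>' \<alpha>"
  shows "\<exists>w. implements w B \<theta> \<theta>'"
proof -
  have aut: "star_automorphism_BG (\<alpha> n)" for n using assms by (simp add: pairing_def)
  obtain w where w: "unitary w" and \<alpha>w: "\<And>x. x \<in> BG \<Longrightarrow> \<alpha> 1 x = w \<circ> x \<circ> adj w"
    using automorphism_implemented[OF aut[of 1]] by metis
  have "\<theta> b = adj w \<circ> b \<circ> w" if b: "b \<in> B" for b
  proof -
    have bB: "b \<in> BG" using b by (rule B_BG)
    have "\<forall>n::nat. \<forall>b\<in>B. \<alpha> (- int n) b = (\<theta> ^^ n) b" using assms unfolding pairing_def by blast
    from this[rule_format, of b 1] b have \<theta>b: "\<theta> b = \<alpha> (-1) b" by simp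
    have "\<forall>m n. \<forall>x\<in>BG. \<alpha> (m + n) x = \<alpha> m (\<alpha> n x)" "\<forall>x\<in>BG. \<alpha> 0 x = x"
      using assms unfolding pairing_def by blast+
    then have "b = \<alpha> 1 (\<alpha> (-1) b)" using bB by (metis add.right_inverse)
    also have "\<dots> = w \<circ> \<theta> b \<circ> adj w"
      using \<alpha>w[of "\<theta> b"] B_BG[OF endo_closed(1)[OF b]] by (simp add: \<theta>b)
    finally have "b v = w (\<theta> b (adj w v))" for v by (metis comp_apply)
    then show ?thesis by (simp add: fun_eq_iff unitary_left[OF w])
  qed
  moreover have "\<theta>' b = w \<circ> b \<circ> adj w" if b: "b \<in> commutant B" for b
  proof -
    have "\<forall>n::nat. \<forall>b'\<in>commutant B. \<alpha> (int n) b' = (\<theta>' ^^ n) b'" using assms unfolding pairing_def by blast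
    from this[rule_format, of b 1] b have "\<theta>' b = \<alpha> 1 b" by simp
    then show ?thesis using \<alpha>w b by (simp add: commutant_def)
  qed
  ultimately show ?thesis using w by (auto simp: implements_def)
qed

lemma implements_imp_iso:
  assumes w: "implements w B \<theta> \<theta>'"
  shows "product_system_iso B \<theta> \<theta>' (\<lambda>n x. (w ^^ n) \<circ> x)"
proof -
  have uw: "unitary w" using w by (simp add: implements_def)
  have U: "unitary (w ^^ n)" for n by (rule unitary_funpow[OF uw])
  have adjU: "adj (w ^^ n) = adj w ^^ n" for n using adj_funpow[OF unitary_BG[OF uw]] by simp
  have UB: "w ^^ n \<in> BG" for n by (rule unitary_BG[OF U])
  have l: "(adj w ^^ n) ((w ^^ n) v) = v" and r: "(w ^^ n) ((adj w ^^ n) v) = v" for n v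
    using unitary_left[OF U, of n v] unitary_right[OF U, of n v] by (simp_all add: adjU)
  note pow = implements_funpow[OF w]
  have F: "(\<lambda>x. (w ^^ n) \<circ> x) ` B = F_space B \<theta>' n" for n
  proof (intro equalityI subsetI)
    fix y assume "y \<in> (\<lambda>x. (w ^^ n) \<circ> x) ` B"
    then obtain x where x: "x \<in> B" "y = (w ^^ n) \<circ> x" by blast
    have "(\<theta>' ^^ n) b \<circ> y = y \<circ> b" if "b \<in> commutant B" for b
      using that x by (auto simp: pow(3) l fun_eq_iff commutant_def)
    then show "y \<in> F_space B \<theta>' n" using x by (simp add: F_space_def comp_BG UB B_BG)
  next
    fix y assume y: "y \<in> F_space B \<theta>' n"
    \<comment> \<open>Removing \<open>w ^^ n\<close> turns the intertwining relation of
      \<open>y\<close> into commutation with \<open>commutant B\<close>, so \<open>x\<close> lies in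
      the bicommutant, which is \<open>B\<close>.\<close>
    define x where "x = (adj w ^^ n) \<circ> y"
    have "x \<in> commutant (commutant B)" unfolding commutant_def[of "commutant B"]
    proof (intro CollectI conjI ballI)
      show "x \<in> BG" using y adj_BG[OF UB, of n] by (simp add: x_def comp_BG F_space_def adjU)
      fix b assume b: "b \<in> commutant B"
      then have "(\<theta>' ^^ n) b (y v) = y (b v)" for v using y by (auto simp: F_space_def fun_eq_iff)
      then have "(w ^^ n) (b (x v)) = y (b v)" for v using b by (simp add: pow(3) x_def)
      then show "x \<circ> b = b \<circ> x" unfolding fun_eq_iff comp_apply by (metis comp_apply l x_def)
    qed
    then have "x \<in> B" by (simp add: B_bicommutant)
    moreover have "y = (w ^^ n) \<circ> x" by (simp add: x_def fun_eq_iff r)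
    ultimately show "y \<in> (\<lambda>x. (w ^^ n) \<circ> x) ` B" by blast
  qed
  show ?thesis unfolding product_system_iso_def
  proof (intro conjI allI ballI F)
    fix n k x y c b assume x: "x \<in> B"
    show "(w ^^ n) \<circ> opscale c x = opscale c ((w ^^ n) \<circ> x)"
      by (simp add: opscale_def fun_eq_iff BG_scaleC[OF UB])
    show "(w ^^ 0) \<circ> x = x" by simp
    assume y: "y \<in> B"
    show "adj ((w ^^ n) \<circ> x) \<circ> ((w ^^ n) \<circ> y) = adj x \<circ> y"
      by (simp add: adj_comp[OF UB B_BG[OF x]] adjU fun_eq_iff l)
    show "(w ^^ n) \<circ> opadd x y = opadd ((w ^^ n) \<circ> x) ((w ^^ n) \<circ> y)"
      by (simp add: opadd_def fun_eq_iff BG_add[OF UB])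
    show "(w ^^ n) \<circ> ((\<theta> ^^ n) x \<circ> y) = x \<circ> ((w ^^ n) \<circ> y)"
      by (simp add: pow(2)[OF x] fun_eq_iff r)
    show "(w ^^ n) \<circ> (y \<circ> x) = (w ^^ n) \<circ> y \<circ> x" by (simp add: comp_assoc)
    show "(w ^^ (k + n)) \<circ> ((\<theta> ^^ n) x \<circ> y) = (w ^^ k) \<circ> x \<circ> ((w ^^ n) \<circ> y)"
      by (simp add: pow(2)[OF x] fun_eq_iff r funpow_add)
  qed
qed

text \<open>Put \<open>w = u 1 id\<close>. Inner products make \<open>w\<close> isometric, right
  linearity gives \<open>u 1 x = w \<circ> x\<close>, left linearity gives
  \<open>b \<circ> w = w \<circ> \<theta> b\<close>, and membership in
  \<open>F_space B \<theta>' 1\<close> gives the relation for \<open>\<theta>'\<close>. Surjectivity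
  of \<open>w\<close> comes from \<open>intertwiners_total\<close>.\<close>

lemma iso_imp_implements:
  assumes "product_system_iso B \<theta> \<theta>' u"
  shows "\<exists>w. implements w B \<theta> \<theta>'"
proof -
  note iso = assms[unfolded product_system_iso_def]
  have F: "u 1 ` B = F_space B \<theta>' 1" using iso[THEN conjunct1] by (rule spec)
  have inn: "\<forall>x\<in>B. \<forall>y\<in>B. adj (u 1 x) \<circ> u 1 y = adj x \<circ> y"
    using iso[THEN conjunct2, THEN conjunct1] by (rule spec)
  have left: "\<forall>b\<in>B. \<forall>x\<in>B. u 1 ((\<theta> ^^ 1) b \<circ> x) = b \<circ> u 1 x"
    using iso[THEN conjunct2, THEN conjunct2, THEN conjunct2, THEN conjunct2, THEN conjunct1] by (rule spec)
  have right: "\<forall>b\<in>B. \<forall>x\<in>B. u 1 (x \<circ> b) = u 1 x \<circ> b"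
    using iso[THEN conjunct2, THEN conjunct2, THEN conjunct2, THEN conjunct2, THEN conjunct2, THEN conjunct1]
    by (rule spec)
  define w where "w = u 1 id"
  have wF: "w \<in> F_space B \<theta>' 1" using F B_id by (auto simp: w_def)
  then have wB: "w \<in> BG" by (simp add: F_space_def)
  have isom: "adj w \<circ> w = id" using inn B_id by (simp add: w_def adj_id)
  have ux: "u 1 x = w \<circ> x" if "x \<in> B" for x
    using right[rule_format, OF that B_id] by (simp add: w_def)
  have bw: "b \<circ> w = w \<circ> \<theta> b" if "b \<in> B" for b
    using left[rule_format, OF that B_id] ux[OF endo_closed(1)[OF that]] by (simp add: w_def)
  have bw': "\<theta>' b \<circ> w = w \<circ> b" if "b \<in> commutant B" for b
    using wF that by (auto simp: F_space_def)
  interpret normal_rep "commutant B" \<theta>'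
  proof
    show "von_neumann_algebra (commutant B)" by (rule von_neumann_algebra_commutant[OF B])
    show "star_hom (commutant B) BG \<theta>'" "normal_map (commutant B) \<theta>'"
      using \<theta>' by (auto simp: normal_unital_star_endo_def star_hom_def commutant_def)
  qed
  have "w (adj w v) = v" for v
  proof (rule ccontr)
    assume "w (adj w v) \<noteq> v"
    \<comment> \<open>The component of \<open>v\<close> orthogonal to the range of \<open>w\<close>.
      Every intertwiner factors through \<open>w\<close>, so none can detect a nonzero
      \<open>\<xi>\<close>.\<close>
    define \<xi> where "\<xi> = v - w (adj w v)"
    have "adj w \<xi> = 0" using isom by (simp add: \<xi>_def BG_diff[OF adj_BG[OF wB]] fun_eq_iff)
    have "\<xi> \<noteq> 0" using \<open>w (adj w v) \<noteq> v\<close> by (simp add: \<xi>_def)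
    then obtain y a where y: "y \<in> BG" "\<And>m. m \<in> commutant B \<Longrightarrow> \<theta>' m \<circ> y = y \<circ> m" "inner (y a) \<xi> \<noteq> 0"
      by (rule intertwiners_total) blast
    then have "y \<in> F_space B \<theta>' 1" by (simp add: F_space_def)
    then obtain x where "x \<in> B" "y = w \<circ> x" using F ux by auto
    then have "inner (y a) \<xi> = inner (x a) (adj w \<xi>)" by (simp add: inner_adj[OF wB])
    then show False using y(3) \<open>adj w \<xi> = 0\<close> by simp
  qed
  then have w: "unitary w" using wB isom by (simp add: unitary_def fun_eq_iff)
  have "\<theta> b = adj w \<circ> b \<circ> w" if "b \<in> B" for b
    using bw[OF that] by (simp add: fun_eq_iff unitary_left[OF w])
  moreover have "\<theta>' b = w \<circ> b \<circ> adj w" if "b \<in> commutant B" for b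
  proof
    fix v
    show "\<theta>' b v = (w \<circ> b \<circ> adj w) v"
      using fun_cong[OF bw'[OF that], of "adj w v"] by (simp add: unitary_right[OF w])
  qed
  ultimately show ?thesis using w by (auto simp: implements_def)
qed

end

section \<open>Integer powers of a unitary and the resulting automorphism group\<close>

definition int_pow :: "('a::complex_hilbert) op \<Rightarrow> int \<Rightarrow> 'a op" where
  "int_pow w n = (if 0 \<le> n then w ^^ nat n else adj w ^^ nat (- n))"

lemma int_pow_nat: "int_pow w (int n) = w ^^ n" "int_pow w (- int n) = adj w ^^ n"
  by (simp add: int_pow_def) (cases "n = 0"; simp add: int_pow_def)

lemma int_pow_succ:
  assumes w: "unitary w"
  shows "int_pow w (n + 1) = int_pow w n \<circ> w"
proof (cases n rule: int_cases2)
  case (nonneg k)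
  then have "n + 1 = int (Suc k)" by simp
  then show ?thesis unfolding nonneg by (simp only: int_pow_nat funpow_Suc_right)
next
  case (nonpos k)
  show ?thesis
  proof (cases k)
    case 0
    then show ?thesis using nonpos int_pow_nat(1)[of w 1] int_pow_nat(1)[of w 0] by simp
  next
    case (Suc j)
    then have "n + 1 = - int j" "n = - int (Suc j)" using nonpos by simp_all
    then have "int_pow w (n + 1) = adj w ^^ j" "int_pow w n = (adj w ^^ j) \<circ> adj w"
      by (simp_all only: int_pow_nat funpow_Suc_right)
    then show ?thesis by (simp add: fun_eq_iff unitary_left[OF w])
  qed
qed

lemma int_pow_add:
  assumes w: "unitary w"
  shows "int_pow w (m + n) = int_pow w m \<circ> int_pow w n"
proof (induction n rule: int_induct[of _ 0])
  case base
  show ?case using int_pow_nat(1)[of w 0] by simp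
next
  case (step1 i)
  then show ?case using int_pow_succ[OF w, of i] int_pow_succ[OF w, of "m + i"] by (simp add: add.assoc comp_assoc)
next
  case (step2 i)
  \<comment> \<open>The successor law at \<open>j - 1\<close>, multiplied by \<open>adj w\<close> on
    the right, gives the downward step.\<close>
  have pred: "int_pow w (j - 1) = int_pow w j \<circ> adj w" for j
    using int_pow_succ[OF w, of "j - 1"] by (simp add: fun_eq_iff unitary_right[OF w])
  show ?case using step2 pred[of i] pred[of "m + i"] by (simp add: algebra_simps comp_assoc)
qed

lemma unitary_int_pow: "unitary w \<Longrightarrow> unitary (int_pow w n)"
  by (simp add: int_pow_def unitary_funpow unitary_adj)

lemma adj_int_pow:
  assumes w: "unitary w"
  shows "adj (int_pow w n) = int_pow w (- n)"
proof (cases n rule: int_cases2)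
  case (nonneg k)
  then show ?thesis using adj_funpow[OF unitary_BG[OF w]] by (simp add: int_pow_nat)
next
  case (nonpos k)
  then show ?thesis using adj_funpow[OF adj_BG[OF unitary_BG[OF w]]] adj_adj[OF unitary_BG[OF w]]
    by (simp add: int_pow_nat)
qed

text \<open>Additivity of \<open>int_pow\<close> gives the group law of the conjugations. Since the
  adjoint of a power is the opposite power, they restrict to the iterates of \<open>\<theta>\<close>
  and \<open>\<theta>'\<close>.\<close>

lemma implements_imp_pairing:
  assumes "von_neumann_algebra B" "normal_unital_star_endo B \<theta>"
    and "normal_unital_star_endo (commutant B) \<theta>'" and w: "implements w B \<theta> \<theta>'"
  shows "pairing B \<theta> \<theta>' (\<lambda>n x. int_pow w n \<circ> x \<circ> adj (int_pow w n))"
proof -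
  have uw: "unitary w" using w by (simp add: implements_def)
  note pow = implements_funpow[OF assms]
  have id0: "int_pow w 0 = id" using int_pow_nat(1)[of w 0] by simp
  show ?thesis unfolding pairing_def
  proof (intro conjI allI ballI)
    show "star_automorphism_BG (\<lambda>x. int_pow w n \<circ> x \<circ> adj (int_pow w n))" for n
      by (rule star_automorphism_conj[OF unitary_int_pow[OF uw]])
    show "int_pow w 0 \<circ> x \<circ> adj (int_pow w 0) = x" for x by (simp add: id0 adj_id)
    show "int_pow w (m + n) \<circ> x \<circ> adj (int_pow w (m + n))
      = int_pow w m \<circ> (int_pow w n \<circ> x \<circ> adj (int_pow w n)) \<circ> adj (int_pow w m)" for m n x
      unfolding int_pow_add[OF uw] adj_comp[OF unitary_BG[OF unitary_int_pow[OF uw]] unitary_BG[OF unitary_int_pow[OF uw]]]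
      by (simp add: comp_assoc)
    show "int_pow w (- int n) \<circ> b \<circ> adj (int_pow w (- int n)) = (\<theta> ^^ n) b" if "b \<in> B" for n b
      unfolding pow(2)[OF that] adj_int_pow[OF uw] by (simp add: int_pow_nat)
    show "int_pow w (int n) \<circ> b \<circ> adj (int_pow w (int n)) = (\<theta>' ^^ n) b" if "b \<in> commutant B" for n b
      unfolding pow(3)[OF that] adj_int_pow[OF uw] by (simp add: int_pow_nat)
  qed
qed

theorem theorem7p3:
  fixes B :: "('a::complex_hilbert) op set"
    and \<theta> \<theta>' :: "'a op \<Rightarrow> 'a op"
  assumes "von_neumann_algebra B"
    and "normal_unital_star_endo B \<theta>"
    and "normal_unital_star_endo (commutant B) \<theta>'"
  shows "can_be_paired B \<theta> \<theta>' \<longleftrightarrow> (\<exists>u. product_system_iso B \<theta> \<theta>' u)"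
  unfolding can_be_paired_def
  using pairing_imp_implements[OF assms] implements_imp_iso[OF assms]
    iso_imp_implements[OF assms] implements_imp_pairing[OF assms]
  by blast

end
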